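(* Consider the linear network model with latent agents, observed through the data $\{(p_O^{(t)},y_O^{(t)})\}_{t\in[n]}$, with diagonally dominant $M$. Suppose that for some constants $\theta>1$, $\tilde C>0$ and some bijection $\ell:V\to\{1,\dots,|V|\}$, $$G_{ij}\le\frac{\tilde C}{(1+|\ell(i)-\ell(j)|)^\theta}\quad\text{for all }i,j\in V.$$ Suppose that the design is regular with respect to $(s_n,r_{1n})$, where $s_n=(n/\log|V_O|)^{1/(2\theta)}$ and $r_{1n}=\frac{\tilde C_12^\theta}{\theta-1}\big(\frac{\log|V_O|}n\big)^{(\theta-1)/(2\theta)}$, $\tilde C_1>0$ being a constant for which $H^{-1}$ admits an $(s_n,r_{1n})$-sparse approximation (such a constant exists under the decay condition). Let $\check W$ and $\check W^\mu$ be the debiased and thresholded estimators defined in the context, with thresholds satisfying $2|\check W_{kj}-(H^{-1})_{kj}|\le\mu_{kj}\le C_1\sqrt{\log|V_O|/n}$ for all $k,j\in V_O$ and a constant $C_1$. Then with probability $1-o(1)$ $$\max\big\{\|\check W^\mu-H^{-1}\|_\infty,\ \|\check W^\mu-H^{-1}\|_1\big\}\le\Big(\tilde C_2+\frac{\tilde C_32^\theta}{\theta-1}\Big)\Big(\frac{\log|V_O|}n\Big)^{(\theta-1)/(2\theta)}$$ for some constants $\tilde C_2,\tilde C_3>0$.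
   Context: **Asymptotics.** $n$ is the number of periods, $[n]=\{1,\dots,n\}$; limits are as $n\to\infty$. The network, its sizes, all model parameters, the data distribution, $s_n,r_{1n},M_\varepsilon,M_\Psi$ may depend on $n$. A "constant" is a number not depending on $n$ or on the network sizes. **Model.** $V=V_O\sqcup V_L$ is a finite set of agents (observable and latent), $G\in\mathbb R_{\ge0}^{V\times V}$ the weights, $\Lambda=\mathrm{diag}(\lambda_i)_{i\in V}$, $M=\Lambda-G$. Outcomes in period $t$ are $y^{(t)}=M^{-1}(a+\xi^{(t)}-p^{(t)})$, with intercepts $a\in\mathbb R^V$, covariates $p^{(t)}\in\mathbb R^V$ and zero-mean shocks $\xi^{(t)}$, independent over $t$ (possibly correlated across agents). Latent covariates are fixed: $p^{(t)}_i=p_0$ for $i\in V_L$. Subscripts $O,L$ denote sub-vectors/blocks for $V_O,V_L$. Put $S_{OL}=M_{OL}M_{LL}^{-1}$, $H=M_{OO}-M_{OL}M_{LL}^{-1}M_{LO}$, $v_O=H^{-1}a_O-H^{-1}S_{OL}(a_L-p_L)$, $\varepsilon_O^{(t)}=H^{-1}\xi_O^{(t)}-H^{-1}S_{OL}\xi_L^{(t)}$, so that $$y_O^{(t)}=v_O-H^{-1}p_O^{(t)}+\varepsilon_O^{(t)}.\qquad( * )$$ Standing assumptions: $|a_i|\le\bar a$, $|\lambda_i|\le\bar\lambda$, $|p_i^{(t)}|\le\bar p$ for all $i,t$ with constants $\bar a,\bar\lambda,\bar p$; and (diagonal dominance) there is a constant $\zeta>0$ with $\lambda_i\ge\sum_jG_{ij}+\zeta$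 and $\lambda_i\ge\sum_jG_{ji}+\zeta$ for all $i$. Only $\{(p_O^{(t)},y_O^{(t)})\}$ is observed. **Norms and indices.** $\|A\|_1,\|A\|_\infty$ are the maximum absolute column and row sums; $A_{k,\cdot}$ and $A_{\cdot,k}$ the $k$th row and column. $\bar V_O=\{0\}\cup V_O$; $(1;p_O^{(t)})\in\mathbb R^{\bar V_O}$ has $0$th entry $1$ and $j$th entry $p_j^{(t)}$. $\mathbf 1_{kj}=1$ if $k=j$, else $0$. $\Phi$ is the standard normal CDF. **Sparse approximation.** A matrix is $s$-sparse if each row and each column has at most $s$ nonzero entries. $H^{-1}$ admits an $(s,r_1)$-sparse approximation if there is an $s$-sparse $\bar W$ with $\max\{\|H^{-1}-\bar W\|_1,\|H^{-1}-\bar W\|_\infty\}\le r_1$. **Regular design.** The design is regular with respect to $(s_n,r_{1n})$ if $H^{-1}$ admits an $(s_n,r_{1n})$-sparse approximation and, for constants $0<c<C$, $C'>0$ and parameters $M_\varepsilon,M_\Psi\ge1$: 1. the data $(p_O^{(t)},y_O^{(t)})$, $t\in[n]$, are i.i.d. and satisfy $( * )$, and $E[\varepsilon_O^{(t)}\mid p_O^{(t)}]=0$; 2. for all $t$: $\min_{j\in V_O}E[(\varepsilon_j^{(t)})^2\mid p_O^{(t)}]\ge c$, $\max_{j\in V_O}E[|\varepsilon_j^{(t)}|^4\mid p_O^{(t)}]\le C$, and $E[\max_{t\in[n],j\in V_O}|\varepsilon_j^{(t)}|^4\mid\{p_O^{(t)}\}]\le M_\varepsilon$; 3. $\bar\Psi:=E[(1;p_O^{(t)})(1;p_O^{(t)})^T]^{-1}$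 satisfies $\min_{k,j\in\bar V_O}E[\{\bar\Psi_{k,\cdot}(1;p_O^{(t)})(1;p_O^{(t)})_j-\mathbf 1_{kj}\}^2]\ge c$, $\max_{k,j\in\bar V_O}E[|\bar\Psi_{k,\cdot}(1;p_O^{(t)})(1;p_O^{(t)})_j|^4]\le C$, $E[\max_{t\in[n];j,k\in\bar V_O}|\bar\Psi_{k,\cdot}(1;p_O^{(t)})(1;p_O^{(t)})_j|^4]\le M_\Psi$, and the eigenvalues of $\bar\Psi$ are bounded above by a constant; 4. $s_n^2(\log|V_O|)(\log n)^3=o(n)$, $M_\varepsilon M_\Psi\log|V_O|=o(n)$, $C'\log|V_O|\ge\log n$. **Estimators.** Put $M_n^2=1\vee\max_{k\in V_O}\frac1n\sum_t(p_k^{(t)})^4$, $\tau=\frac1{4M_n}$, $\lambda=\frac1{\sqrt n}\Phi^{-1}\big(1-\frac1{3n|V_O|^2}\big)$, $\hat\Sigma=\frac1n\sum_t(1;p_O^{(t)})(1;p_O^{(t)})^T$. Step 1: $(\hat W,\hat v,\hat z)$ minimizes $\sum_{k\in V_O}\big(\|(\tilde v_k,\tilde W_{k,\cdot})\|_1+\tau z_k\big)$ over $(\tilde W,\tilde v,z)$ subject to, for all $k\in V_O$, $j\in\bar V_O$: $\big|\frac1n\sum_t\{y_k^{(t)}-(\tilde v_k-\tilde W_{k,\cdot}p_O^{(t)})\}(1;p_O^{(t)})_j\big|\le\lambda z_k$ and $\big\{\frac1n\sum_t\{y_k^{(t)}-(\tilde v_k-\tilde W_{k,\cdot}p_O^{(t)})\}^2(1;p_O^{(t)})_j^2\big\}^{1/2}\le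 z_k$. Step 2: $\hat\Psi\in\mathbb R^{\bar V_O\times\bar V_O}$ is the $\Psi$-part of a minimizer of $\sum_{k\in\bar V_O}\big\{\big(\frac1n\sum_t|\Psi_{k,\cdot}(1;p_O^{(t)})|^4\big)^{1/4}+z_k\big\}$ over $(z,\Psi)$ subject to, for all $k,j\in\bar V_O$: $|\Psi_{k,\cdot}\hat\Sigma_{\cdot,j}-\mathbf 1_{kj}|\le\lambda z_k$ and $\big\{\frac1n\sum_t\{\Psi_{k,\cdot}(1;p_O^{(t)})(1;p_O^{(t)})_j-\mathbf 1_{kj}\}^2\big\}^{1/2}\le z_k$. Step 3 (debiased estimator): $(-\check v^T;\check W^T)=(-\hat v^T;\hat W^T)-\hat\Psi\big\{\frac1n\sum_t(1;p_O^{(t)})\{y_O^{(t)}-(\hat v-\hat Wp_O^{(t)})\}^T\big\}$. Step 4 (thresholded estimator, for thresholds $\mu_{kj}$): $\check W^\mu_{kj}=\check W_{kj}\,1\{|\check W_{kj}|>\mu_{kj}\}$, $k,j\in V_O$. *)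

theory Defs
  imports "HOL-Probability.Probability" "HOL-Library.Landau_Symbols"
begin

section \<open>Matrices indexed by finite sets\<close>

text \<open>The index sets vary with \<open>n\<close>, so a matrix is a function of two indices together with
  finite index sets; values outside the index sets are irrelevant.\<close>

definition mmul :: "'k set \<Rightarrow> ('i \<Rightarrow> 'k \<Rightarrow> real) \<Rightarrow> ('k \<Rightarrow> 'j \<Rightarrow> real) \<Rightarrow> 'i \<Rightarrow> 'j \<Rightarrow> real" where
  "mmul K A B i j = (\<Sum>k\<in>K. A i k * B k j)"

definition mvec :: "'k set \<Rightarrow> ('i \<Rightarrow> 'k \<Rightarrow> real) \<Rightarrow> ('k \<Rightarrow> real) \<Rightarrow> 'i \<Rightarrow> real" where
  "mvec K A x i = (\<Sum>k\<in>K. A i k * x k)"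

definition inverse_on :: "'i set \<Rightarrow> ('i \<Rightarrow> 'i \<Rightarrow> real) \<Rightarrow> ('i \<Rightarrow> 'i \<Rightarrow> real) \<Rightarrow> bool" where
  "inverse_on I A B \<longleftrightarrow>
     (\<forall>i\<in>I. \<forall>j\<in>I. mmul I A B i j = of_bool (i = j) \<and> mmul I B A i j = of_bool (i = j))"

definition invertible_on :: "'i set \<Rightarrow> ('i \<Rightarrow> 'i \<Rightarrow> real) \<Rightarrow> bool" where
  "invertible_on I A \<longleftrightarrow> (\<exists>B. inverse_on I A B)"

text \<open>On \<open>I \<times> I\<close> the inverse of an invertible matrix is unique, so the choice below only affects
  entries outside \<open>I \<times> I\<close>.\<close>

definition minv :: "'i set \<Rightarrow> ('i \<Rightarrow> 'i \<Rightarrow> real) \<Rightarrow> 'i \<Rightarrow> 'i \<Rightarrow> real" where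
  "minv I A = (SOME B. inverse_on I A B)"

definition eigenvalue_on :: "'i set \<Rightarrow> ('i \<Rightarrow> 'i \<Rightarrow> real) \<Rightarrow> real \<Rightarrow> bool" where
  "eigenvalue_on I A e \<longleftrightarrow> (\<exists>x. (\<exists>i\<in>I. x i \<noteq> 0) \<and> (\<forall>i\<in>I. mvec I A x i = e * x i))"

definition norm_1 :: "'i set \<Rightarrow> ('i \<Rightarrow> 'i \<Rightarrow> real) \<Rightarrow> real" where
  "norm_1 I A = Max ((\<lambda>j. \<Sum>i\<in>I. \<bar>A i j\<bar>) ` I)"

definition norm_inf :: "'i set \<Rightarrow> ('i \<Rightarrow> 'i \<Rightarrow> real) \<Rightarrow> real" where
  "norm_inf I A = Max ((\<lambda>i. \<Sum>j\<in>I. \<bar>A i j\<bar>) ` I)"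

definition sparse_on :: "'i set \<Rightarrow> real \<Rightarrow> ('i \<Rightarrow> 'i \<Rightarrow> real) \<Rightarrow> bool" where
  "sparse_on I s A \<longleftrightarrow>
     (\<forall>i\<in>I. real (card {j\<in>I. A i j \<noteq> 0}) \<le> s) \<and> (\<forall>j\<in>I. real (card {i\<in>I. A i j \<noteq> 0}) \<le> s)"

definition sparse_approximation :: "'i set \<Rightarrow> real \<Rightarrow> real \<Rightarrow> ('i \<Rightarrow> 'i \<Rightarrow> real) \<Rightarrow> bool" where
  "sparse_approximation I s r A \<longleftrightarrow>
     (\<exists>W. sparse_on I s W \<and>
        max (norm_1 I (\<lambda>i j. A i j - W i j)) (norm_inf I (\<lambda>i j. A i j - W i j)) \<le> r)"


section \<open>The network and the outcome model\<close>

record 'v network =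
  obs :: "'v set"
  lat :: "'v set"
  wgt :: "'v \<Rightarrow> 'v \<Rightarrow> real"
  lam :: "'v \<Rightarrow> real"

definition agents :: "'v network \<Rightarrow> 'v set" where
  "agents N = obs N \<union> lat N"

definition M_mat :: "'v network \<Rightarrow> 'v \<Rightarrow> 'v \<Rightarrow> real" where
  "M_mat N i j = of_bool (i = j) * lam N i - wgt N i j"

text \<open>Blocks such as \<open>M\<^sub>O\<^sub>L\<close> are the same function \<open>M_mat\<close>, restricted by the index sets over which
  it is used.\<close>

definition S_mat :: "'v network \<Rightarrow> 'v \<Rightarrow> 'v \<Rightarrow> real" where
  "S_mat N = mmul (lat N) (M_mat N) (minv (lat N) (M_mat N))"

definition H_mat :: "'v network \<Rightarrow> 'v \<Rightarrow> 'v \<Rightarrow> real" where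
  "H_mat N i j = M_mat N i j - mmul (lat N) (S_mat N) (M_mat N) i j"

definition H_inv :: "'v network \<Rightarrow> 'v \<Rightarrow> 'v \<Rightarrow> real" where
  "H_inv N = minv (obs N) (H_mat N)"

definition dominant_network :: "real \<Rightarrow> real \<Rightarrow> 'v network \<Rightarrow> bool" where
  "dominant_network lbar \<zeta> N \<longleftrightarrow>
     finite (obs N) \<and> finite (lat N) \<and> obs N \<inter> lat N = {} \<and>
     (\<forall>i\<in>agents N. \<forall>j\<in>agents N. 0 \<le> wgt N i j) \<and>
     (\<forall>i\<in>agents N. \<bar>lam N i\<bar> \<le> lbar) \<and>
     (\<forall>i\<in>agents N. (\<Sum>j\<in>agents N. wgt N i j) + \<zeta> \<le> lam N i) \<and>
     (\<forall>i\<in>agents N. (\<Sum>j\<in>agents N. wgt N j i) + \<zeta> \<le> lam N i)"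

definition decaying_weights :: "real \<Rightarrow> real \<Rightarrow> ('v \<Rightarrow> nat) \<Rightarrow> 'v network \<Rightarrow> bool" where
  "decaying_weights \<theta> Ct l N \<longleftrightarrow>
     bij_betw l (agents N) {1..card (agents N)} \<and>
     (\<forall>i\<in>agents N. \<forall>j\<in>agents N.
        wgt N i j \<le> Ct / (1 + \<bar>real (l i) - real (l j)\<bar>) powr \<theta>)"

text \<open>Random quantities take a period, an agent and a sample point; \<open>lcov\<close> is the common fixed
  covariate \<open>p\<^sub>0\<close> of the latent agents.\<close>

record ('v, 'w) model =
  net :: "'v network"
  icpt :: "'v \<Rightarrow> real"
  lcov :: real
  prb :: "'w measure"
  pcov :: "nat \<Rightarrow> 'v \<Rightarrow> 'w \<Rightarrow> real"
  shock :: "nat \<Rightarrow> 'v \<Rightarrow> 'w \<Rightarrow> real"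

definition outcome :: "('v, 'w) model \<Rightarrow> nat \<Rightarrow> 'v \<Rightarrow> 'w \<Rightarrow> real" where
  "outcome m t i \<omega> =
     mvec (agents (net m)) (minv (agents (net m)) (M_mat (net m)))
       (\<lambda>j. icpt m j + shock m t j \<omega> - pcov m t j \<omega>) i"

definition v_obs :: "('v, 'w) model \<Rightarrow> 'v \<Rightarrow> real" where
  "v_obs m k =
     mvec (obs (net m)) (H_inv (net m)) (icpt m) k -
     mvec (obs (net m)) (H_inv (net m))
       (mvec (lat (net m)) (S_mat (net m)) (\<lambda>l. icpt m l - lcov m)) k"

definition eps_obs :: "('v, 'w) model \<Rightarrow> nat \<Rightarrow> 'v \<Rightarrow> 'w \<Rightarrow> real" where
  "eps_obs m t k \<omega> =
     mvec (obs (net m)) (H_inv (net m)) (\<lambda>i. shock m t i \<omega>) k -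
     mvec (obs (net m)) (H_inv (net m))
       (mvec (lat (net m)) (S_mat (net m)) (\<lambda>l. shock m t l \<omega>)) k"

definition standing_assumptions ::
    "real \<Rightarrow> real \<Rightarrow> real \<Rightarrow> real \<Rightarrow> nat \<Rightarrow> ('v, 'w) model \<Rightarrow> bool" where
  "standing_assumptions abar lbar pbar \<zeta> n m \<longleftrightarrow>
     dominant_network lbar \<zeta> (net m) \<and>
     prob_space (prb m) \<and>
     (\<forall>i\<in>agents (net m). \<bar>icpt m i\<bar> \<le> abar) \<and>
     (\<forall>t\<in>{1..n}. \<forall>i\<in>agents (net m). AE \<omega> in prb m. \<bar>pcov m t i \<omega>\<bar> \<le> pbar) \<and>
     (\<forall>t\<in>{1..n}. \<forall>i\<in>lat (net m). \<forall>\<omega>\<in>space (prb m). pcov m t i \<omega> = lcov m) \<and>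
     (\<forall>t\<in>{1..n}. \<forall>i\<in>agents (net m).
        integrable (prb m) (shock m t i) \<and> integral\<^sup>L (prb m) (shock m t i) = 0) \<and>
     prob_space.indep_vars (prb m) (\<lambda>_. PiM (agents (net m)) (\<lambda>_. borel))
       (\<lambda>t \<omega>. \<lambda>i\<in>agents (net m). shock m t i \<omega>) {1..n}"


section \<open>Regular designs\<close>

text \<open>The index \<open>0\<close> adjoined to the observable agents is \<open>None\<close>.\<close>

definition ext_index :: "'v set \<Rightarrow> 'v option set" where
  "ext_index V = insert None (Some ` V)"

definition ext_vec :: "('v \<Rightarrow> real) \<Rightarrow> 'v option \<Rightarrow> real" where
  "ext_vec x j = (case j of None \<Rightarrow> 1 | Some i \<Rightarrow> x i)"

definition cov_ext :: "('v, 'w) model \<Rightarrow> nat \<Rightarrow> 'w \<Rightarrow> 'v option \<Rightarrow> real" where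
  "cov_ext m t \<omega> = ext_vec (\<lambda>i. pcov m t i \<omega>)"

definition second_moment :: "('v, 'w) model \<Rightarrow> nat \<Rightarrow> 'v option \<Rightarrow> 'v option \<Rightarrow> real" where
  "second_moment m t i j = (\<integral>\<omega>. cov_ext m t \<omega> i * cov_ext m t \<omega> j \<partial>prb m)"

definition Psi_bar :: "('v, 'w) model \<Rightarrow> nat \<Rightarrow> 'v option \<Rightarrow> 'v option \<Rightarrow> real" where
  "Psi_bar m t = minv (ext_index (obs (net m))) (second_moment m t)"

definition score :: "('v, 'w) model \<Rightarrow> nat \<Rightarrow> 'v option \<Rightarrow> 'v option \<Rightarrow> 'w \<Rightarrow> real" where
  "score m t k j \<omega> =
     mvec (ext_index (obs (net m))) (Psi_bar m t) (cov_ext m t \<omega>) k * cov_ext m t \<omega> j"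

definition obs_borel :: "('v, 'w) model \<Rightarrow> ('v \<Rightarrow> real) measure" where
  "obs_borel m = PiM (obs (net m)) (\<lambda>_. borel)"

definition obs_cov :: "('v, 'w) model \<Rightarrow> nat \<Rightarrow> 'w \<Rightarrow> 'v \<Rightarrow> real" where
  "obs_cov m t \<omega> = (\<lambda>i\<in>obs (net m). pcov m t i \<omega>)"

definition obs_data :: "('v, 'w) model \<Rightarrow> nat \<Rightarrow> 'w \<Rightarrow> ('v \<Rightarrow> real) \<times> ('v \<Rightarrow> real)" where
  "obs_data m t \<omega> = (obs_cov m t \<omega>, \<lambda>i\<in>obs (net m). outcome m t i \<omega>)"

definition cov_algebra :: "('v, 'w) model \<Rightarrow> nat \<Rightarrow> 'w measure" where
  "cov_algebra m t = vimage_algebra (space (prb m)) (obs_cov m t) (obs_borel m)"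

definition all_cov_algebra :: "nat \<Rightarrow> ('v, 'w) model \<Rightarrow> 'w measure" where
  "all_cov_algebra n m =
     vimage_algebra (space (prb m)) (\<lambda>\<omega>. \<lambda>t\<in>{1..n}. obs_cov m t \<omega>) (PiM {1..n} (\<lambda>_. obs_borel m))"

definition regular_data :: "nat \<Rightarrow> ('v, 'w) model \<Rightarrow> bool" where
  "regular_data n m \<longleftrightarrow>
     prob_space.indep_vars (prb m) (\<lambda>_. obs_borel m \<Otimes>\<^sub>M obs_borel m) (obs_data m) {1..n} \<and>
     (\<forall>t\<in>{1..n}. distr (prb m) (obs_borel m \<Otimes>\<^sub>M obs_borel m) (obs_data m t) =
                 distr (prb m) (obs_borel m \<Otimes>\<^sub>M obs_borel m) (obs_data m 1)) \<and>
     (\<forall>t\<in>{1..n}. \<forall>k\<in>obs (net m). \<forall>\<omega>\<in>space (prb m).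
        outcome m t k \<omega> =
          v_obs m k - mvec (obs (net m)) (H_inv (net m)) (\<lambda>j. pcov m t j \<omega>) k + eps_obs m t k \<omega>) \<and>
     (\<forall>t\<in>{1..n}. \<forall>k\<in>obs (net m).
        AE \<omega> in prb m. real_cond_exp (prb m) (cov_algebra m t) (eps_obs m t k) \<omega> = 0)"

text \<open>Conditional moments are taken in \<open>ennreal\<close>, so that an upper bound also expresses finiteness.\<close>

definition regular_noise :: "real \<Rightarrow> real \<Rightarrow> real \<Rightarrow> nat \<Rightarrow> ('v, 'w) model \<Rightarrow> bool" where
  "regular_noise c C Me n m \<longleftrightarrow>
     (\<forall>t\<in>{1..n}. \<forall>j\<in>obs (net m). AE \<omega> in prb m.
        ennreal c \<le> nn_cond_exp (prb m) (cov_algebra m t) (\<lambda>\<omega>. ennreal ((eps_obs m t j \<omega>)\<^sup>2)) \<omega>) \<and>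
     (\<forall>t\<in>{1..n}. \<forall>j\<in>obs (net m). AE \<omega> in prb m.
        nn_cond_exp (prb m) (cov_algebra m t) (\<lambda>\<omega>. ennreal (\<bar>eps_obs m t j \<omega>\<bar> ^ 4)) \<omega> \<le> ennreal C) \<and>
     (AE \<omega> in prb m.
        nn_cond_exp (prb m) (all_cov_algebra n m)
          (\<lambda>\<omega>. ennreal (Max ((\<lambda>(t, j). \<bar>eps_obs m t j \<omega>\<bar> ^ 4) ` ({1..n} \<times> obs (net m))))) \<omega>
        \<le> ennreal Me)"

definition regular_covariates ::
    "real \<Rightarrow> real \<Rightarrow> real \<Rightarrow> real \<Rightarrow> nat \<Rightarrow> ('v, 'w) model \<Rightarrow> bool" where
  "regular_covariates c C CPsi MP n m \<longleftrightarrow>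
     (\<forall>t\<in>{1..n}. invertible_on (ext_index (obs (net m))) (second_moment m t)) \<and>
     (\<forall>t\<in>{1..n}. \<forall>k\<in>ext_index (obs (net m)). \<forall>j\<in>ext_index (obs (net m)).
        c \<le> (\<integral>\<omega>. (score m t k j \<omega> - of_bool (k = j))\<^sup>2 \<partial>prb m)) \<and>
     (\<forall>t\<in>{1..n}. \<forall>k\<in>ext_index (obs (net m)). \<forall>j\<in>ext_index (obs (net m)).
        (\<integral>\<omega>. \<bar>score m t k j \<omega>\<bar> ^ 4 \<partial>prb m) \<le> C) \<and>
     (\<integral>\<omega>. Max ((\<lambda>(t, k, j). \<bar>score m t k j \<omega>\<bar> ^ 4) `
              ({1..n} \<times> ext_index (obs (net m)) \<times> ext_index (obs (net m)))) \<partial>prb m) \<le> MP \<and>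
     (\<forall>t\<in>{1..n}. \<forall>e. eigenvalue_on (ext_index (obs (net m))) (Psi_bar m t) e \<longrightarrow> e \<le> CPsi)"

text \<open>A design is a sequence of models indexed by the number of periods \<open>n\<close>; the conditions on the
  individual models are required for all large \<open>n\<close>.\<close>

definition num_obs :: "('v, 'w) model \<Rightarrow> real" where
  "num_obs m = real (card (obs (net m)))"

definition regular_design ::
    "real \<Rightarrow> real \<Rightarrow> real \<Rightarrow> real \<Rightarrow> (nat \<Rightarrow> real) \<Rightarrow> (nat \<Rightarrow> real) \<Rightarrow> (nat \<Rightarrow> real) \<Rightarrow> (nat \<Rightarrow> real) \<Rightarrow>
     (nat \<Rightarrow> ('v, 'w) model) \<Rightarrow> bool" where
  "regular_design c C C' CPsi s r Me MP m \<longleftrightarrow>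
     (\<forall>\<^sub>F n in sequentially.
        sparse_approximation (obs (net (m n))) (s n) (r n) (H_inv (net (m n))) \<and>
        1 \<le> Me n \<and> 1 \<le> MP n \<and>
        regular_data n (m n) \<and>
        regular_noise c C (Me n) n (m n) \<and>
        regular_covariates c C CPsi (MP n) n (m n) \<and>
        ln (real n) \<le> C' * ln (num_obs (m n))) \<and>
     (\<lambda>n. (s n)\<^sup>2 * ln (num_obs (m n)) * (ln (real n)) ^ 3) \<in> o(\<lambda>n. real n) \<and>
     (\<lambda>n. Me n * MP n * ln (num_obs (m n))) \<in> o(\<lambda>n. real n)"


section \<open>Estimators\<close>

text \<open>Functions of the realised data: \<open>p t i\<close> and \<open>y t i\<close> for periods \<open>t\<close> in \<open>{1..n}\<close> and agents \<open>i\<close>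
  in the observable set \<open>V\<close>.\<close>

definition tune_lambda :: "nat \<Rightarrow> 'v set \<Rightarrow> real" where
  "tune_lambda n V =
     1 / sqrt (real n) *
     inv (cdf std_normal_distribution) (1 - 1 / (3 * real n * (real (card V))\<^sup>2))"

definition tune_tau :: "nat \<Rightarrow> 'v set \<Rightarrow> (nat \<Rightarrow> 'v \<Rightarrow> real) \<Rightarrow> real" where
  "tune_tau n V p =
     1 / (4 * sqrt (max 1 (Max ((\<lambda>k. 1 / real n * (\<Sum>t=1..n. p t k ^ 4)) ` V))))"

definition resid ::
    "'v set \<Rightarrow> (nat \<Rightarrow> 'v \<Rightarrow> real) \<Rightarrow> (nat \<Rightarrow> 'v \<Rightarrow> real) \<Rightarrow> ('v \<Rightarrow> 'v \<Rightarrow> real) \<Rightarrow> ('v \<Rightarrow> real) \<Rightarrow>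
     nat \<Rightarrow> 'v \<Rightarrow> real" where
  "resid V p y W v t k = y t k - (v k - mvec V W (p t) k)"

definition step1_feasible ::
    "nat \<Rightarrow> 'v set \<Rightarrow> (nat \<Rightarrow> 'v \<Rightarrow> real) \<Rightarrow> (nat \<Rightarrow> 'v \<Rightarrow> real) \<Rightarrow>
     ('v \<Rightarrow> 'v \<Rightarrow> real) \<times> ('v \<Rightarrow> real) \<times> ('v \<Rightarrow> real) \<Rightarrow> bool" where
  "step1_feasible n V p y = (\<lambda>(W, v, z). \<forall>k\<in>V. \<forall>j\<in>ext_index V.
     \<bar>1 / real n * (\<Sum>t=1..n. resid V p y W v t k * ext_vec (p t) j)\<bar> \<le> tune_lambda n V * z k \<and>
     sqrt (1 / real n * (\<Sum>t=1..n. (resid V p y W v t k)\<^sup>2 * (ext_vec (p t) j)\<^sup>2)) \<le> z k)"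

definition step1_objective ::
    "nat \<Rightarrow> 'v set \<Rightarrow> (nat \<Rightarrow> 'v \<Rightarrow> real) \<Rightarrow>
     ('v \<Rightarrow> 'v \<Rightarrow> real) \<times> ('v \<Rightarrow> real) \<times> ('v \<Rightarrow> real) \<Rightarrow> real" where
  "step1_objective n V p =
     (\<lambda>(W, v, z). \<Sum>k\<in>V. (\<bar>v k\<bar> + (\<Sum>j\<in>V. \<bar>W k j\<bar>)) + tune_tau n V p * z k)"

definition Sigma_hat :: "nat \<Rightarrow> (nat \<Rightarrow> 'v \<Rightarrow> real) \<Rightarrow> 'v option \<Rightarrow> 'v option \<Rightarrow> real" where
  "Sigma_hat n p i j = 1 / real n * (\<Sum>t=1..n. ext_vec (p t) i * ext_vec (p t) j)"

definition step2_feasible ::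
    "nat \<Rightarrow> 'v set \<Rightarrow> (nat \<Rightarrow> 'v \<Rightarrow> real) \<Rightarrow>
     ('v option \<Rightarrow> real) \<times> ('v option \<Rightarrow> 'v option \<Rightarrow> real) \<Rightarrow> bool" where
  "step2_feasible n V p = (\<lambda>(z, \<Psi>). \<forall>k\<in>ext_index V. \<forall>j\<in>ext_index V.
     \<bar>mmul (ext_index V) \<Psi> (Sigma_hat n p) k j - of_bool (k = j)\<bar> \<le> tune_lambda n V * z k \<and>
     sqrt (1 / real n * (\<Sum>t=1..n.
       (mvec (ext_index V) \<Psi> (ext_vec (p t)) k * ext_vec (p t) j - of_bool (k = j))\<^sup>2)) \<le> z k)"

definition step2_objective ::
    "nat \<Rightarrow> 'v set \<Rightarrow> (nat \<Rightarrow> 'v \<Rightarrow> real) \<Rightarrow>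
     ('v option \<Rightarrow> real) \<times> ('v option \<Rightarrow> 'v option \<Rightarrow> real) \<Rightarrow> real" where
  "step2_objective n V p =
     (\<lambda>(z, \<Psi>). \<Sum>k\<in>ext_index V.
        root 4 (1 / real n * (\<Sum>t=1..n. \<bar>mvec (ext_index V) \<Psi> (ext_vec (p t)) k\<bar> ^ 4)) + z k)"

text \<open>The matrix \<open>(-v\<^sup>T; W\<^sup>T)\<close> after debiasing: its row \<open>None\<close> is the negated intercept estimate, and
  its row \<open>Some j\<close> is the \<open>j\<close>th column of the estimate of \<open>H\<^sup>-\<^sup>1\<close>.\<close>

definition debiased ::
    "nat \<Rightarrow> 'v set \<Rightarrow> (nat \<Rightarrow> 'v \<Rightarrow> real) \<Rightarrow> (nat \<Rightarrow> 'v \<Rightarrow> real) \<Rightarrow>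
     ('v \<Rightarrow> 'v \<Rightarrow> real) \<Rightarrow> ('v \<Rightarrow> real) \<Rightarrow> ('v option \<Rightarrow> 'v option \<Rightarrow> real) \<Rightarrow>
     'v option \<Rightarrow> 'v \<Rightarrow> real" where
  "debiased n V p y W v \<Psi> i k =
     (case i of None \<Rightarrow> - v k | Some j \<Rightarrow> W k j) -
     mmul (ext_index V) \<Psi>
       (\<lambda>i k. 1 / real n * (\<Sum>t=1..n. ext_vec (p t) i * resid V p y W v t k)) i k"

definition debiased_W ::
    "nat \<Rightarrow> 'v set \<Rightarrow> (nat \<Rightarrow> 'v \<Rightarrow> real) \<Rightarrow> (nat \<Rightarrow> 'v \<Rightarrow> real) \<Rightarrow>
     ('v \<Rightarrow> 'v \<Rightarrow> real) \<Rightarrow> ('v \<Rightarrow> real) \<Rightarrow> ('v option \<Rightarrow> 'v option \<Rightarrow> real) \<Rightarrow>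
     'v \<Rightarrow> 'v \<Rightarrow> real" where
  "debiased_W n V p y W v \<Psi> k j = debiased n V p y W v \<Psi> (Some j) k"

definition threshold :: "('v \<Rightarrow> 'v \<Rightarrow> real) \<Rightarrow> ('v \<Rightarrow> 'v \<Rightarrow> real) \<Rightarrow> 'v \<Rightarrow> 'v \<Rightarrow> real" where
  "threshold \<mu> W k j = (if \<mu> k j < \<bar>W k j\<bar> then W k j else 0)"

text \<open>\<open>W\<close> is a debiased estimator for the model \<open>m\<close> with \<open>n\<close> periods. Minimizers need not be unique;
  any choice, possibly a different one at each sample point, is admitted.\<close>

definition debiased_estimator ::
    "nat \<Rightarrow> ('v, 'w) model \<Rightarrow> ('w \<Rightarrow> 'v \<Rightarrow> 'v \<Rightarrow> real) \<Rightarrow> bool" where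
  "debiased_estimator n m W \<longleftrightarrow>
     (\<forall>\<omega>\<in>space (prb m). \<exists>W1 v1 z1 z2 \<Psi>.
        let V = obs (net m); p = (\<lambda>t i. pcov m t i \<omega>); y = (\<lambda>t i. outcome m t i \<omega>) in
        is_arg_min (step1_objective n V p) (step1_feasible n V p y) (W1, v1, z1) \<and>
        is_arg_min (step2_objective n V p) (step2_feasible n V p) (z2, \<Psi>) \<and>
        (\<forall>k\<in>V. \<forall>j\<in>V. W \<omega> k j = debiased_W n V p y W1 v1 \<Psi> k j))"


section \<open>Asymptotics\<close>

text \<open>Probability \<open>1 - o(1)\<close>. The event is only required to contain measurable events whose
  probabilities tend to 1, because minimizers and thresholds need not be measurable. For measurable
  events this is the usual notion.\<close>

definition with_high_probability :: "(nat \<Rightarrow> 'w measure) \<Rightarrow> (nat \<Rightarrow> 'w \<Rightarrow> bool) \<Rightarrow> bool" where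
  "with_high_probability P Q \<longleftrightarrow>
     (\<exists>A. (\<forall>n. A n \<in> sets (P n) \<and> (\<forall>\<omega>\<in>A n. Q n \<omega>)) \<and> (\<lambda>n. measure (P n) (A n)) \<longlonglongrightarrow> 1)"

definition s_rate :: "real \<Rightarrow> nat \<Rightarrow> real \<Rightarrow> real" where
  "s_rate \<theta> n d = (real n / ln d) powr (1 / (2 * \<theta>))"

definition r_rate :: "real \<Rightarrow> real \<Rightarrow> nat \<Rightarrow> real \<Rightarrow> real" where
  "r_rate \<theta> K n d = K * 2 powr \<theta> / (\<theta> - 1) * (ln d / real n) powr ((\<theta> - 1) / (2 * \<theta>))"

end

theory Submission
  imports Defs
begin

text \<open>\<open>H\<^sup>-\<^sup>1\<close> is the \<open>OO\<close> block of \<open>M\<^sup>-\<^sup>1\<close>. Diagonal dominance bounds the absolute row and column sums of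
  \<open>M\<^sup>-\<^sup>1\<close> by \<open>1 / \<zeta>\<close>, and the equation \<open>M M\<^sup>-\<^sup>1 = I\<close> passes the tail rate \<open>b powr (1 - \<theta>)\<close> of the weights
  on to \<open>M\<^sup>-\<^sup>1\<close>; keeping only the entries with \<open>|l(i) - l(j)| < s / 3\<close> is then the sparse approximation.

  The error bound is deterministic on the event of the threshold hypothesis. With
  \<open>2 |W - H\<^sup>-\<^sup>1| \<le> \<mu>\<close>, every thresholded entry has error at most \<open>3 \<mu> / 2\<close> and at most the modulus of the
  entry of \<open>H\<^sup>-\<^sup>1\<close>. The first bound is used on the support of the sparse approximation, the second off it,
  and \<open>s\<^sub>n\<close> makes the two contributions \<open>s\<^sub>n \<surd>(ln d / n)\<close> and \<open>r\<^sub>n\<close> of the same order.\<close>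

section \<open>Inverses of matrices on finite index sets\<close>

text \<open>\<open>B = B (A C) = (B A) C = C\<close>, written out entrywise with all index sums over
  \<open>I\<close>.\<close>

lemma left_inverse_eq_right_inverse:
  assumes I: "finite I"
    and BA: "\<And>i j. i \<in> I \<Longrightarrow> j \<in> I \<Longrightarrow> mmul I B A i j = of_bool (i = j)"
    and AC: "\<And>i j. i \<in> I \<Longrightarrow> j \<in> I \<Longrightarrow> mmul I A C i j = of_bool (i = j)"
    and ij: "i \<in> I" "j \<in> I"
  shows "B i j = C i j"
proof -
  have "B i j = (\<Sum>k\<in>I. B i k * mmul I A C k j)"
    using I ij by (simp add: AC of_bool_def if_distrib[of "\<lambda>x. _ * x"] sum.delta cong: if_cong)
  also have "\<dots> = (\<Sum>k\<in>I. \<Sum>l\<in>I. B i k * A k l * C l j)"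
    by (simp add: mmul_def sum_distrib_left mult.assoc)
  also have "\<dots> = (\<Sum>l\<in>I. \<Sum>k\<in>I. B i k * A k l * C l j)"
    by (rule sum.swap)
  also have "\<dots> = (\<Sum>l\<in>I. mmul I B A i l * C l j)"
    by (simp add: mmul_def sum_distrib_right)
  also have "\<dots> = C i j"
    using I ij by (simp add: BA of_bool_def if_distrib[of "\<lambda>x. x * _"] sum.delta cong: if_cong)
  finally show ?thesis .
qed

lemma inverse_on_minv: "inverse_on I A B \<Longrightarrow> inverse_on I A (minv I A)"
  unfolding minv_def by (rule someI[of "inverse_on I A"])

lemma minv_eq:
  assumes "finite I" "inverse_on I A B" "i \<in> I" "j \<in> I"
  shows "minv I A i j = B i j"
  using assms(1) _ _ assms(3,4)
  by (rule left_inverse_eq_right_inverse[where A = A])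
     (use inverse_on_minv[OF assms(2)] assms(2) in \<open>auto simp: inverse_on_def\<close>)


section \<open>Row diagonally dominant matrices\<close>

text \<open>The shape of \<open>M_mat\<close> with diagonal and weights as separate arguments, so
  that transposing \<open>G\<close> transposes the matrix.\<close>

definition dom_mat :: "('i \<Rightarrow> real) \<Rightarrow> ('i \<Rightarrow> 'i \<Rightarrow> real) \<Rightarrow> 'i \<Rightarrow> 'i \<Rightarrow> real" where
  "dom_mat u G i j = of_bool (i = j) * u i - G i j"

text \<open>Column dominance is the same predicate for the transposed weights, so every row estimate
  also yields a column estimate.\<close>

definition row_dominant :: "real \<Rightarrow> 'i set \<Rightarrow> ('i \<Rightarrow> real) \<Rightarrow> ('i \<Rightarrow> 'i \<Rightarrow> real) \<Rightarrow> bool" where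
  "row_dominant \<zeta> I u G \<longleftrightarrow>
     finite I \<and> (\<forall>i\<in>I. \<forall>j\<in>I. 0 \<le> G i j) \<and> (\<forall>i\<in>I. (\<Sum>j\<in>I. G i j) + \<zeta> \<le> u i)"

text \<open>Dropping nonnegative weights only lowers the row sums. This passes dominance on to the
  latent block.\<close>

lemma row_dominant_subset:
  assumes "row_dominant \<zeta> I u G" "J \<subseteq> I"
  shows "row_dominant \<zeta> J u G"
proof -
  have "(\<Sum>j\<in>J. G i j) \<le> (\<Sum>j\<in>I. G i j)" if "i \<in> J" for i
    using assms that by (intro sum_mono2) (auto simp: row_dominant_def)
  moreover have "(\<Sum>j\<in>I. G i j) + \<zeta> \<le> u i" if "i \<in> J" for i
    using assms that by (auto simp: row_dominant_def)
  ultimately have "(\<Sum>j\<in>J. G i j) + \<zeta> \<le> u i" if "i \<in> J" for i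
    using that by (meson add_right_mono order_trans)
  then show ?thesis
    using assms by (auto simp: row_dominant_def subset_iff intro: finite_subset)
qed

lemma row_dominant_diag_ge:
  assumes "row_dominant \<zeta> I u G" "i \<in> I"
  shows "\<zeta> \<le> u i"
proof -
  have "0 \<le> (\<Sum>j\<in>I. G i j)"
    using assms by (auto simp: row_dominant_def intro!: sum_nonneg)
  then show ?thesis
    using assms unfolding row_dominant_def by fastforce
qed

section \<open>Existence of a two-sided inverse\<close>

lemma mmul_dom_mat:
  assumes "finite I" "i \<in> I"
  shows "mmul I (dom_mat u G) X i j = u i * X i j - (\<Sum>k\<in>I. G i k * X k j)"
proof -
  have "(\<Sum>k\<in>I. of_bool (i = k) * u i * X k j) = u i * X i j"
    using assms by (simp add: of_bool_def if_distrib[of "\<lambda>x. x * _"] sum.delta' cong: if_cong)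
  then show ?thesis
    by (simp add: mmul_def dom_mat_def left_diff_distrib sum_subtractf)
qed

text \<open>Jacobi iteration \<open>x := (b + G x) / u\<close> started at 0. Nonnegative weights
  make it monotone, dominance keeps it below \<open>1 / \<zeta>\<close>, and its limit solves the
  system. The right-hand sides to be inserted are unit vectors, which lie between 0 and 1.\<close>

lemma row_dominant_solvable:
  assumes dom: "row_dominant \<zeta> I u G" and \<zeta>: "\<zeta> > 0"
    and b: "\<And>i. 0 \<le> b i" "\<And>i. b i \<le> 1"
  shows "\<exists>x. \<forall>i\<in>I. u i * x i - (\<Sum>k\<in>I. G i k * x k) = b i"
proof -
  define x where "x = rec_nat (\<lambda>_. 0) (\<lambda>_ x i. (b i + (\<Sum>k\<in>I. G i k * x k)) / u i)"
  have x0: "x 0 i = 0" for i by (simp add: x_def)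
  have xS: "x (Suc n) i = (b i + (\<Sum>k\<in>I. G i k * x n k)) / u i" for n i by (simp add: x_def)
  have u: "u i > 0" if "i \<in> I" for i
    using row_dominant_diag_ge[OF dom that] \<zeta> by simp
  have G: "0 \<le> G i j" if "i \<in> I" "j \<in> I" for i j
    using dom that by (simp add: row_dominant_def)
  \<comment> \<open>The constant vector \<open>1 / \<zeta>\<close> is a supersolution:
    \<open>1 + (u i - \<zeta>) / \<zeta> = u i / \<zeta>\<close>.\<close>
  have bound: "\<forall>i\<in>I. x n i \<le> 1 / \<zeta>" for n
  proof (induction n)
    case 0
    then show ?case using \<zeta> by (simp add: x0)
  next
    case (Suc n)
    show ?case
    proof
      fix i assume i: "i \<in> I"
      have "(\<Sum>k\<in>I. G i k * x n k) \<le> (\<Sum>k\<in>I. G i k * (1 / \<zeta>))"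
        using Suc G i by (intro sum_mono mult_left_mono) auto
      also have "\<dots> = (\<Sum>k\<in>I. G i k) / \<zeta>"
        by (simp add: sum_divide_distrib)
      also have "\<dots> \<le> (u i - \<zeta>) / \<zeta>"
        using dom i \<zeta> by (intro divide_right_mono) (auto simp: row_dominant_def algebra_simps)
      finally have "b i + (\<Sum>k\<in>I. G i k * x n k) \<le> 1 + (u i - \<zeta>) / \<zeta>"
        using b(2)[of i] by linarith
      also have "\<dots> = u i / \<zeta>"
        using \<zeta> by (simp add: field_simps)
      finally show "x (Suc n) i \<le> 1 / \<zeta>"
        using u[OF i] by (simp add: xS field_simps)
    qed
  qed
  \<comment> \<open>The start is \<open>x 0 = 0 \<le> b / u = x 1\<close>; nonnegativity of
    \<open>G\<close> carries the order through every iteration.\<close>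
  have mono: "\<forall>i\<in>I. x n i \<le> x (Suc n) i" for n
  proof (induction n)
    case 0
    then show ?case using b u by (simp add: x0 xS less_imp_le)
  next
    case (Suc n)
    show ?case
    proof
      fix i assume i: "i \<in> I"
      have "(\<Sum>k\<in>I. G i k * x n k) \<le> (\<Sum>k\<in>I. G i k * x (Suc n) k)"
        using Suc G i by (intro sum_mono mult_left_mono) auto
      then show "x (Suc n) i \<le> x (Suc (Suc n)) i"
        using u[OF i] unfolding xS[of "Suc n"] xS[of n i]
        by (intro divide_right_mono add_left_mono) auto
    qed
  qed
  define y where "y i = lim (\<lambda>n. x n i)" for i
  have lim: "(\<lambda>n. x n i) \<longlonglongrightarrow> y i" if i: "i \<in> I" for i
  proof -
    have "incseq (\<lambda>n. x n i)"
      using mono i by (intro incseq_SucI) auto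
    moreover have "\<forall>n. x n i \<le> 1 / \<zeta>" using bound i by auto
    ultimately have "convergent (\<lambda>n. x n i)"
      by (metis incseq_convergent convergentI)
    then show ?thesis
      by (simp add: y_def convergent_LIMSEQ_iff)
  qed
  have "y i = (b i + (\<Sum>k\<in>I. G i k * y k)) / u i" if i: "i \<in> I" for i
  proof (rule LIMSEQ_unique)
    show "(\<lambda>n. x (Suc n) i) \<longlonglongrightarrow> y i"
      using lim[OF i] by (rule LIMSEQ_Suc)
    show "(\<lambda>n. x (Suc n) i) \<longlonglongrightarrow> (b i + (\<Sum>k\<in>I. G i k * y k)) / u i"
      unfolding xS using u[OF i] by (intro tendsto_intros lim) auto
  qed
  then have "\<forall>i\<in>I. u i * y i - (\<Sum>k\<in>I. G i k * y k) = b i"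
    using u by (fastforce simp: field_simps)
  then show ?thesis by blast
qed

lemma row_dominant_right_inverse:
  assumes dom: "row_dominant \<zeta> I u G" and \<zeta>: "\<zeta> > 0"
  shows "\<exists>X. \<forall>i\<in>I. \<forall>j\<in>I. mmul I (dom_mat u G) X i j = of_bool (i = j)"
proof -
  \<comment> \<open>The columns are solved for one at a time: \<open>x j\<close> is column
    \<open>j\<close>, hence the swapped indices in the witness below.\<close>
  have "\<exists>x. \<forall>i\<in>I. u i * x i - (\<Sum>k\<in>I. G i k * x k) = of_bool (i = j)" for j
    by (rule row_dominant_solvable[OF dom \<zeta>]) auto
  then obtain x where x: "\<And>j. \<forall>i\<in>I. u i * x j i - (\<Sum>k\<in>I. G i k * x j k) = of_bool (i = j)"
    by metis
  have "finite I" using dom by (simp add: row_dominant_def)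
  then have "\<forall>i\<in>I. \<forall>j\<in>I. mmul I (dom_mat u G) (\<lambda>i j. x j i) i j = of_bool (i = j)"
    using x by (simp add: mmul_dom_mat)
  then show ?thesis by blast
qed

lemma dom_mat_transpose: "dom_mat u (\<lambda>i j. G j i) = (\<lambda>i j. dom_mat u G j i)"
  by (auto simp: dom_mat_def fun_eq_iff)

lemma mmul_transpose: "mmul I (\<lambda>i j. A j i) (\<lambda>i j. B j i) i j = mmul I B A j i"
  by (simp add: mmul_def mult.commute)

text \<open>Row dominance yields a right inverse. A right inverse of the transposed matrix,
  transposed back, is a left inverse, and the two agree on \<open>I\<close>.\<close>

lemma dominant_inverse:
  assumes dom: "row_dominant \<zeta> I u G" "row_dominant \<zeta> I u (\<lambda>i j. G j i)" and \<zeta>: "\<zeta> > 0"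
  shows "\<exists>X. inverse_on I (dom_mat u G) X"
proof -
  have I: "finite I" using dom by (simp add: row_dominant_def)
  obtain X where X: "\<forall>i\<in>I. \<forall>j\<in>I. mmul I (dom_mat u G) X i j = of_bool (i = j)"
    using row_dominant_right_inverse[OF dom(1) \<zeta>] by blast
  obtain Y where Y: "\<forall>i\<in>I. \<forall>j\<in>I. mmul I (dom_mat u (\<lambda>i j. G j i)) Y i j = of_bool (i = j)"
    using row_dominant_right_inverse[OF dom(2) \<zeta>] by blast
  define Z where "Z = (\<lambda>i j. Y j i)"
  have Z: "mmul I Z (dom_mat u G) i j = of_bool (i = j)" if "i \<in> I" "j \<in> I" for i j
    using Y that mmul_transpose[of I "dom_mat u G" Z j i]
    by (auto simp: Z_def dom_mat_transpose[of u G])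
  have ZX: "Z i j = X i j" if "i \<in> I" "j \<in> I" for i j
    using I Z _ that by (rule left_inverse_eq_right_inverse) (use X in auto)
  have "mmul I X (dom_mat u G) i j = mmul I Z (dom_mat u G) i j" if "i \<in> I" "j \<in> I" for i j
    unfolding mmul_def using ZX that by (intro sum.cong) auto
  then show ?thesis
    unfolding inverse_on_def using X Z by (intro exI[of _ X]) simp
qed

section \<open>Bounds on the entries and row sums of the inverse\<close>

text \<open>Entry \<open>(i, j)\<close> of \<open>M X = I\<close>, solved for its diagonal term and
  estimated by the triangle inequality; \<open>u\<close> and \<open>G\<close> are nonnegative and
  pass through the absolute values.\<close>

lemma right_inverse_entry_bound:
  assumes dom: "row_dominant \<zeta> I u G" and \<zeta>: "\<zeta> > 0"
    and X: "\<forall>i\<in>I. \<forall>j\<in>I. mmul I (dom_mat u G) X i j = of_bool (i = j)"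
    and ij: "i \<in> I" "j \<in> I"
  shows "u i * \<bar>X i j\<bar> \<le> of_bool (i = j) + (\<Sum>k\<in>I. G i k * \<bar>X k j\<bar>)"
proof -
  have I: "finite I" using dom by (simp add: row_dominant_def)
  have "u i * X i j = of_bool (i = j) + (\<Sum>k\<in>I. G i k * X k j)"
    using X ij mmul_dom_mat[OF I ij(1), of u G X j] by simp
  moreover have "\<bar>u i * X i j\<bar> = u i * \<bar>X i j\<bar>"
    using row_dominant_diag_ge[OF dom ij(1)] \<zeta> by (simp add: abs_mult)
  ultimately have "u i * \<bar>X i j\<bar> \<le> of_bool (i = j) + \<bar>\<Sum>k\<in>I. G i k * X k j\<bar>"
    by (smt (verit) abs_triangle_ineq abs_of_nonneg of_bool_def)
  also have "\<bar>\<Sum>k\<in>I. G i k * X k j\<bar> \<le> (\<Sum>k\<in>I. \<bar>G i k * X k j\<bar>)"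
    by (rule sum_abs)
  also have "\<dots> = (\<Sum>k\<in>I. G i k * \<bar>X k j\<bar>)"
    using dom ij by (intro sum.cong) (auto simp: row_dominant_def abs_mult)
  finally show ?thesis by simp
qed

text \<open>In the row \<open>m\<close> with the largest absolute sum \<open>f m\<close>, the entry
  bounds add up to \<open>u m * f m \<le> 1 + (u m - \<zeta>) * f m\<close>, that is
  \<open>\<zeta> * f m \<le> 1\<close>.\<close>

lemma right_inverse_row_sum:
  assumes dom: "row_dominant \<zeta> I u G" and \<zeta>: "\<zeta> > 0"
    and X: "\<forall>i\<in>I. \<forall>j\<in>I. mmul I (dom_mat u G) X i j = of_bool (i = j)"
    and i: "i \<in> I"
  shows "(\<Sum>j\<in>I. \<bar>X i j\<bar>) \<le> 1 / \<zeta>"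
proof -
  have I: "finite I" using dom by (simp add: row_dominant_def)
  define f where "f i = (\<Sum>j\<in>I. \<bar>X i j\<bar>)" for i
  obtain m where m: "m \<in> I" "\<And>k. k \<in> I \<Longrightarrow> f k \<le> f m"
  proof -
    have "Max (f ` I) \<in> f ` I" using I i by (intro Max_in) auto
    then obtain m where "m \<in> I" "f m = Max (f ` I)" by auto
    then show ?thesis using that[of m] I by auto
  qed
  have fm: "0 \<le> f m" unfolding f_def by (intro sum_nonneg) auto
  have "u m * f m = (\<Sum>j\<in>I. u m * \<bar>X m j\<bar>)"
    by (simp add: f_def sum_distrib_left)
  also have "\<dots> \<le> (\<Sum>j\<in>I. of_bool (m = j) + (\<Sum>k\<in>I. G m k * \<bar>X k j\<bar>))"
    using right_inverse_entry_bound[OF dom \<zeta> X m(1)] by (intro sum_mono) auto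
  also have "\<dots> = 1 + (\<Sum>j\<in>I. \<Sum>k\<in>I. G m k * \<bar>X k j\<bar>)"
    using I m(1) by (simp add: sum.distrib of_bool_def sum.delta')
  also have "(\<Sum>j\<in>I. \<Sum>k\<in>I. G m k * \<bar>X k j\<bar>) = (\<Sum>k\<in>I. \<Sum>j\<in>I. G m k * \<bar>X k j\<bar>)"
    by (rule sum.swap)
  also have "\<dots> = (\<Sum>k\<in>I. G m k * f k)"
    by (simp add: f_def sum_distrib_left)
  also have "\<dots> \<le> (\<Sum>k\<in>I. G m k * f m)"
    using dom m by (intro sum_mono mult_left_mono) (auto simp: row_dominant_def)
  also have "\<dots> = (\<Sum>k\<in>I. G m k) * f m"
    by (simp add: sum_distrib_right)
  also have "\<dots> \<le> (u m - \<zeta>) * f m"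
    using dom m fm by (intro mult_right_mono) (auto simp: row_dominant_def algebra_simps)
  finally have "f m \<le> 1 / \<zeta>"
    using \<zeta> by (simp add: field_simps)
  then show ?thesis using m(2)[OF i] by (simp add: f_def)
qed


section \<open>Tails of the inverse\<close>

text \<open>If \<open>i\<close> and \<open>j\<close> are at distance at least \<open>b\<close>, then for every \<open>k\<close> either \<open>i\<close> and \<open>k\<close> are at distance
  at least \<open>(1 - \<eta>) b\<close> or \<open>k\<close> and \<open>j\<close> are at distance at least \<open>\<eta> b\<close>. Hence the tail \<open>f\<close> of the rows of
  the inverse satisfies \<open>f(b) \<le> q f(\<eta> b) + K' b\<^sup>-\<^sup>\<alpha>\<close>, and \<open>\<eta>\<close> is taken so close to \<open>1\<close> that
  \<open>q \<eta>\<^sup>-\<^sup>\<alpha> = \<surd>q < 1\<close>, which makes the recursion summable.\<close>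

lemma right_inverse_row_tail:
  fixes pos :: "'i \<Rightarrow> real"
  assumes dom: "row_dominant \<zeta> I u G" and \<zeta>: "\<zeta> > 0"
    and X: "\<forall>i\<in>I. \<forall>j\<in>I. mmul I (dom_mat u G) X i j = of_bool (i = j)"
    and u: "\<And>i. i \<in> I \<Longrightarrow> u i \<le> L" and L: "\<zeta> < L"
    and \<alpha>: "\<alpha> > 0" and K: "K \<ge> 0"
    and tail: "\<And>i b. i \<in> I \<Longrightarrow> b > 0 \<Longrightarrow>
        (\<Sum>k | k \<in> I \<and> b \<le> \<bar>pos i - pos k\<bar>. G i k) \<le> K * b powr (- \<alpha>)"
    and q: "q = 1 - \<zeta> / L"
    and \<eta>: "\<eta> = q powr (1 / (2 * \<alpha>))"
    and A: "A = K * (1 - \<eta>) powr (- \<alpha>) / \<zeta>\<^sup>2 / (1 - sqrt q)"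
    and i: "i \<in> I" and b: "b > 0"
  shows "(\<Sum>j | j \<in> I \<and> b \<le> \<bar>pos i - pos j\<bar>. \<bar>X i j\<bar>) \<le> A * b powr (- \<alpha>)"
proof -
  have I: "finite I" using dom by (simp add: row_dominant_def)
  have q01: "0 < q" "q < 1" using \<zeta> L by (auto simp: q field_simps)
  have \<eta>01: "0 < \<eta>" "\<eta> < 1"
    using q01 \<alpha> powr_less_mono2[of "1 / (2 * \<alpha>)" q 1] by (auto simp: \<eta>)
  \<comment> \<open>\<open>\<eta> powr (- \<alpha>)\<close> is \<open>q powr (- 1 / 2)\<close>:
    shrinking the radius by \<open>\<eta>\<close> costs less than the factor \<open>q\<close>
    gains.\<close>
  have \<eta>\<alpha>: "q * \<eta> powr (- \<alpha>) = sqrt q"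
  proof -
    have "q * \<eta> powr (- \<alpha>) = q powr 1 * q powr (- (1 / 2))"
      using q01 \<alpha> by (simp add: \<eta> powr_powr)
    also have "\<dots> = sqrt q"
      by (subst powr_add[symmetric]) (simp add: powr_half_sqrt q01 less_imp_le)
    finally show ?thesis .
  qed
  have sq: "sqrt q < 1" using q01 by simp
  define K' where "K' = K * (1 - \<eta>) powr (- \<alpha>) / \<zeta>\<^sup>2"
  \<comment> \<open>\<open>A\<close> is the fixed point of the recursion for the coefficient of
    \<open>b powr (- \<alpha>)\<close>.\<close>
  have A0: "A = sqrt q * A + K'"
  proof -
    have "A * (1 - sqrt q) = K'" using sq by (simp add: A K'_def[symmetric])
    then show ?thesis by (simp add: algebra_simps)
  qed
  have K'0: "K' \<ge> 0" using K by (simp add: K'_def)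
  have A_nonneg: "A \<ge> 0" using K'0 sq by (simp add: A K'_def[symmetric])
  define F where "F i b = {j \<in> I. b \<le> \<bar>pos i - pos j\<bar>}" for i b
  define f where "f i b = (\<Sum>j\<in>F i b. \<bar>X i j\<bar>)" for i b
  have Ffin: "finite (F i b)" and FI: "F i b \<subseteq> I" for i b using I by (auto simp: F_def)
  have fR: "f i b \<le> 1 / \<zeta>" if "i \<in> I" for i b
  proof -
    have "f i b \<le> (\<Sum>j\<in>I. \<bar>X i j\<bar>)"
      unfolding f_def by (intro sum_mono2 I FI) auto
    then show ?thesis using right_inverse_row_sum[OF dom \<zeta> X that] by simp
  qed
  \<comment> \<open>One turn of the recursion; \<open>B\<close> bounds the tails of all rows at the
    smaller radius \<open>\<eta> * b\<close>.\<close>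
  have step: "f i b \<le> q * B + K' * b powr (- \<alpha>)"
    if i: "i \<in> I" and b: "b > 0" and B0: "0 \<le> B" and B: "\<And>k. k \<in> I \<Longrightarrow> f k (\<eta> * b) \<le> B" for i b B
  proof -
    have ui: "\<zeta> \<le> u i" "u i \<le> L" using row_dominant_diag_ge[OF dom i] u[OF i] by auto
    have Gn: "0 \<le> G i k" if "k \<in> I" for k using dom i that by (simp add: row_dominant_def)
    \<comment> \<open>A row \<open>k\<close> near \<open>i\<close> contributes only its own tail. A
      distant row may contribute its whole sum, up to \<open>1 / \<zeta>\<close>, but the weights
      leading to such rows have a small total.\<close>
    have inner: "(\<Sum>j\<in>F i b. \<bar>X k j\<bar>) \<le> B + of_bool (k \<in> F i ((1 - \<eta>) * b)) * (1 / \<zeta>)"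
      if k: "k \<in> I" for k
    proof (cases "k \<in> F i ((1 - \<eta>) * b)")
      case True
      have "(\<Sum>j\<in>F i b. \<bar>X k j\<bar>) \<le> (\<Sum>j\<in>I. \<bar>X k j\<bar>)"
        by (intro sum_mono2 I FI) auto
      then show ?thesis
        using right_inverse_row_sum[OF dom \<zeta> X k] True B0 by simp
    next
      case False
      then have "\<bar>pos i - pos k\<bar> < (1 - \<eta>) * b" using k by (simp add: F_def)
      \<comment> \<open>Triangle inequality for the positions of \<open>i\<close>, \<open>k\<close>
        and \<open>j\<close>.\<close>
      then have "F i b \<subseteq> F k (\<eta> * b)"
        by (auto simp: F_def left_diff_distrib)
      then have "(\<Sum>j\<in>F i b. \<bar>X k j\<bar>) \<le> f k (\<eta> * b)"
        unfolding f_def by (intro sum_mono2 Ffin) auto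
      then show ?thesis using B[OF k] False by simp
    qed
    have "u i * f i b = (\<Sum>j\<in>F i b. u i * \<bar>X i j\<bar>)"
      by (simp add: f_def sum_distrib_left)
    also have "\<dots> \<le> (\<Sum>j\<in>F i b. \<Sum>k\<in>I. G i k * \<bar>X k j\<bar>)"
    proof (rule sum_mono)
      fix j assume "j \<in> F i b"
      \<comment> \<open>Since \<open>b > 0\<close>, the tail omits the diagonal, where
        \<open>of_bool (i = j)\<close> would add 1.\<close>
      then have "j \<in> I" "i \<noteq> j" using b by (auto simp: F_def)
      then show "u i * \<bar>X i j\<bar> \<le> (\<Sum>k\<in>I. G i k * \<bar>X k j\<bar>)"
        using right_inverse_entry_bound[OF dom \<zeta> X i] by fastforce
    qed
    also have "\<dots> = (\<Sum>k\<in>I. \<Sum>j\<in>F i b. G i k * \<bar>X k j\<bar>)"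
      by (rule sum.swap)
    also have "\<dots> = (\<Sum>k\<in>I. G i k * (\<Sum>j\<in>F i b. \<bar>X k j\<bar>))"
      by (simp add: sum_distrib_left)
    also have "\<dots> \<le> (\<Sum>k\<in>I. G i k * (B + of_bool (k \<in> F i ((1 - \<eta>) * b)) * (1 / \<zeta>)))"
      using inner Gn by (intro sum_mono mult_left_mono) auto
    also have "\<dots> = (\<Sum>k\<in>I. G i k) * B + (\<Sum>k\<in>I. G i k * of_bool (k \<in> F i ((1 - \<eta>) * b))) / \<zeta>"
      by (simp add: distrib_left sum.distrib sum_distrib_right sum_divide_distrib)
    also have "(\<Sum>k\<in>I. G i k * of_bool (k \<in> F i ((1 - \<eta>) * b))) = (\<Sum>k\<in>F i ((1 - \<eta>) * b). G i k)"
      using I FI by (intro sum.mono_neutral_cong_right) auto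
    also have "\<dots> \<le> K * ((1 - \<eta>) * b) powr (- \<alpha>)"
      unfolding F_def using tail[OF i, of "(1 - \<eta>) * b"] b \<eta>01 by simp
    also have "\<dots> = K' * \<zeta>\<^sup>2 * b powr (- \<alpha>)"
      using \<eta>01 b \<zeta> by (simp add: K'_def powr_mult)
    also have "(\<Sum>k\<in>I. G i k) * B \<le> (u i - \<zeta>) * B"
      using dom i B0 by (intro mult_right_mono) (auto simp: row_dominant_def algebra_simps)
    finally have main: "u i * f i b \<le> (u i - \<zeta>) * B + K' * \<zeta> * b powr (- \<alpha>)"
      using \<zeta> by (simp add: power2_eq_square divide_right_mono)
    \<comment> \<open>Here the upper bound \<open>u i \<le> L\<close> enters:
      \<open>u i * q = u i - \<zeta> * u i / L\<close>.\<close>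
    have "u i - \<zeta> \<le> u i * q"
      using ui \<zeta> by (simp add: q field_simps)
    then have "(u i - \<zeta>) * B \<le> u i * q * B"
      using B0 by (intro mult_right_mono)
    moreover have "K' * \<zeta> * b powr (- \<alpha>) \<le> K' * u i * b powr (- \<alpha>)"
      using ui K'0 by (intro mult_right_mono mult_left_mono) auto
    ultimately have "u i * f i b \<le> u i * (q * B + K' * b powr (- \<alpha>))"
      using main by (simp add: algebra_simps)
    then show ?thesis using ui \<zeta> by simp
  qed
  \<comment> \<open>The start is the row sum bound. Each turn multiplies the first term by
    \<open>q\<close> and reproduces the second, so only the second survives in the limit.\<close>
  have iter: "\<forall>i\<in>I. \<forall>b>0. f i b \<le> q ^ n * (1 / \<zeta>) + A * b powr (- \<alpha>)" for n
  proof (induction n)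
    case 0
    have "0 \<le> A * b powr (- \<alpha>)" for b using A_nonneg by simp
    then show ?case using fR by (auto intro: add_increasing2)
  next
    case (Suc n)
    show ?case
    proof (intro ballI allI impI)
      fix i and b :: real assume i: "i \<in> I" and b: "0 < b"
      let ?B = "q ^ n * (1 / \<zeta>) + A * (\<eta> * b) powr (- \<alpha>)"
      have "f i b \<le> q * ?B + K' * b powr (- \<alpha>)"
        using Suc b \<eta>01 q01 \<zeta> A_nonneg by (intro step i) auto
      also have "q * ?B = q ^ Suc n * (1 / \<zeta>) + (q * \<eta> powr (- \<alpha>)) * A * b powr (- \<alpha>)"
        using \<eta>01 b by (simp add: powr_mult algebra_simps)
      also have "\<dots> + K' * b powr (- \<alpha>) = q ^ Suc n * (1 / \<zeta>) + (sqrt q * A + K') * b powr (- \<alpha>)"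
        unfolding \<eta>\<alpha> by (simp add: algebra_simps)
      finally show "f i b \<le> q ^ Suc n * (1 / \<zeta>) + A * b powr (- \<alpha>)"
        using A0 by simp
    qed
  qed
  have "(\<lambda>n. q ^ n * (1 / \<zeta>) + A * b powr (- \<alpha>)) \<longlonglongrightarrow> 0 * (1 / \<zeta>) + A * b powr (- \<alpha>)"
    using q01 by (intro tendsto_intros LIMSEQ_power_zero) auto
  then have "f i b \<le> 0 * (1 / \<zeta>) + A * b powr (- \<alpha>)"
    by (rule LIMSEQ_le_const) (use iter i b in auto)
  then show ?thesis by (simp add: f_def F_def)
qed


section \<open>Polynomially decaying weights\<close>

text \<open>Mean value theorem for \<open>x powr (1 - \<theta>)\<close> on
  \<open>[k, k + 1]\<close>; the intermediate point lies below \<open>k + 1\<close> and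
  \<open>z powr (- \<theta>)\<close> decreases.\<close>

lemma powr_le_telescope:
  fixes \<theta> :: real
  assumes "\<theta> > 1" and k: "k \<ge> (1::nat)"
  shows "(1 + real k) powr (- \<theta>) \<le> (real k powr (1 - \<theta>) - real (Suc k) powr (1 - \<theta>)) / (\<theta> - 1)"
proof -
  have "\<exists>z. real k < z \<and> z < real (Suc k) \<and>
      real (Suc k) powr (1 - \<theta>) - real k powr (1 - \<theta>) =
      (real (Suc k) - real k) * ((1 - \<theta>) * z powr (- \<theta>))"
    using k by (intro MVT2) (auto intro!: derivative_eq_intros)
  then obtain z where z: "real k < z" "z < real (Suc k)"
    "real k powr (1 - \<theta>) - real (Suc k) powr (1 - \<theta>) = (\<theta> - 1) * z powr (- \<theta>)"
    by (auto simp: algebra_simps)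
  have "(1 + real k) powr (- \<theta>) \<le> z powr (- \<theta>)"
    using z k assms by (intro powr_mono2') auto
  then show ?thesis using z assms by simp
qed

lemma sum_powr_tail_atLeastLessThan:
  fixes \<theta> :: real
  assumes "\<theta> > 1" "m \<ge> (1::nat)"
  shows "(\<Sum>k\<in>{m..<N}. (1 + real k) powr (- \<theta>)) \<le> real m powr (1 - \<theta>) / (\<theta> - 1)"
proof (cases "m \<le> N")
  case True
  have "(\<Sum>k\<in>{m..<N}. (1 + real k) powr (- \<theta>)) \<le>
      (\<Sum>k\<in>{m..<N}. (real k powr (1 - \<theta>) - real (Suc k) powr (1 - \<theta>)) / (\<theta> - 1))"
    using assms by (intro sum_mono powr_le_telescope) auto
  also have "\<dots> = (real m powr (1 - \<theta>) - real N powr (1 - \<theta>)) / (\<theta> - 1)"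
    unfolding sum_divide_distrib[symmetric]
    \<comment> \<open>The negation turns the differences into the order \<open>Suc k\<close> minus
      \<open>k\<close>.\<close>
    using sum_Suc_diff'[OF True, of "\<lambda>k. - (real k powr (1 - \<theta>))"] by simp
  also have "\<dots> \<le> real m powr (1 - \<theta>) / (\<theta> - 1)"
    using assms by (intro divide_right_mono) auto
  finally show ?thesis .
qed (use assms in auto)

text \<open>An injective \<open>g\<close> with values from \<open>m\<close> on runs through distinct
  terms of the tail, and all terms are nonnegative.\<close>

lemma sum_powr_tail_inj:
  fixes \<theta> :: real and g :: "'i \<Rightarrow> nat"
  assumes "\<theta> > 1" "m \<ge> (1::nat)" "finite S" "inj_on g S" "\<And>j. j \<in> S \<Longrightarrow> m \<le> g j"
  shows "(\<Sum>j\<in>S. (1 + real (g j)) powr (- \<theta>)) \<le> real m powr (1 - \<theta>) / (\<theta> - 1)"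
proof -
  have "(\<Sum>j\<in>S. (1 + real (g j)) powr (- \<theta>)) = (\<Sum>k\<in>g ` S. (1 + real k) powr (- \<theta>))"
    using assms by (simp add: sum.reindex)
  also have "\<dots> \<le> (\<Sum>k\<in>{m..<Suc (Max (g ` S))}. (1 + real k) powr (- \<theta>))"
    using assms by (intro sum_mono2) (auto simp: less_Suc_eq_le)
  also have "\<dots> \<le> real m powr (1 - \<theta>) / (\<theta> - 1)"
    using assms by (intro sum_powr_tail_atLeastLessThan)
  finally show ?thesis .
qed

text \<open>Injective labels meet each distance at most once on either side of \<open>i\<close>, so
  the tail is at most two copies of a power sum; hence the factor 2. With \<open>G\<close> depending
  on the second index only, rows and columns are covered alike.\<close>

lemma decaying_row_tail:
  fixes l :: "'i \<Rightarrow> nat"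
  assumes \<theta>: "\<theta> > 1" and Ct: "Ct \<ge> 0" and I: "finite I" and inj: "inj_on l I"
    and G: "\<And>k. k \<in> I \<Longrightarrow> G k \<le> Ct / (1 + \<bar>real (l i) - real (l k)\<bar>) powr \<theta>"
    and b: "b > 0"
  shows "(\<Sum>k | k \<in> I \<and> b \<le> \<bar>real (l i) - real (l k)\<bar>. G k) \<le>
    2 * Ct / (\<theta> - 1) * b powr (- (\<theta> - 1))"
proof -
  \<comment> \<open>Label distances are integers, so a distance of at least \<open>b\<close> is at
    least \<open>m\<close>; \<open>b > 0\<close> gives \<open>m \<ge> 1\<close>, which the power sum
    needs.\<close>
  define m where "m = nat \<lceil>b\<rceil>"
  have m: "m \<ge> 1" "b \<le> real m" using b by (auto simp: m_def) linarith+
  \<comment> \<open>On each side of \<open>i\<close> the truncated subtraction of labels is the true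
    distance and is injective.\<close>
  define S1 where "S1 = {k \<in> I. b \<le> \<bar>real (l i) - real (l k)\<bar> \<and> l i \<le> l k}"
  define S2 where "S2 = {k \<in> I. b \<le> \<bar>real (l i) - real (l k)\<bar> \<and> l k < l i}"
  have S: "{k. k \<in> I \<and> b \<le> \<bar>real (l i) - real (l k)\<bar>} = S1 \<union> S2" "S1 \<inter> S2 = {}"
    "finite S1" "finite S2"
    using I by (auto simp: S1_def S2_def)
  have mp: "real m powr (1 - \<theta>) \<le> b powr (- (\<theta> - 1))"
    using powr_mono2'[of "1 - \<theta>" b "real m"] m b \<theta> by simp
  have half: "(\<Sum>k\<in>S. G k) \<le> Ct / (\<theta> - 1) * b powr (- (\<theta> - 1))"
    if "S \<subseteq> I" and g: "inj_on g S" "\<And>k. k \<in> S \<Longrightarrow> real (g k) = \<bar>real (l i) - real (l k)\<bar>"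
      "\<And>k. k \<in> S \<Longrightarrow> b \<le> \<bar>real (l i) - real (l k)\<bar>" for S and g :: "'i \<Rightarrow> nat"
  proof -
    have "(\<Sum>k\<in>S. G k) \<le> (\<Sum>k\<in>S. Ct * (1 + real (g k)) powr (- \<theta>))"
      using that G by (intro sum_mono) (auto simp: powr_minus divide_inverse subset_iff)
    also have "\<dots> = Ct * (\<Sum>k\<in>S. (1 + real (g k)) powr (- \<theta>))"
      by (simp add: sum_distrib_left)
    also have "\<dots> \<le> Ct * (real m powr (1 - \<theta>) / (\<theta> - 1))"
    proof (intro mult_left_mono Ct sum_powr_tail_inj \<theta> m g(1))
      show "finite S" using that I finite_subset by blast
      show "m \<le> g k" if "k \<in> S" for k
        using g(2,3)[OF that] unfolding m_def by linarith
    qed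
    also have "\<dots> \<le> Ct * (b powr (- (\<theta> - 1)) / (\<theta> - 1))"
      using mp \<theta> Ct by (intro mult_left_mono divide_right_mono) auto
    finally show ?thesis by simp
  qed
  have "inj_on (\<lambda>k. l k - l i) S1" "inj_on (\<lambda>k. l i - l k) S2"
    using inj by (auto simp: inj_on_def S1_def S2_def)
  then have "(\<Sum>k\<in>S1. G k) \<le> Ct / (\<theta> - 1) * b powr (- (\<theta> - 1))"
    "(\<Sum>k\<in>S2. G k) \<le> Ct / (\<theta> - 1) * b powr (- (\<theta> - 1))"
    by (intro half[of S1 "\<lambda>k. l k - l i"] half[of S2 "\<lambda>k. l i - l k"];
        auto simp: S1_def S2_def of_nat_diff)+
  then show ?thesis
    unfolding S(1) by (simp add: sum.union_disjoint S)
qed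

text \<open>The labels counted are distinct integers in an open interval of radius
  \<open>s / 3\<close> around \<open>l i\<close>.\<close>

lemma card_near_le:
  fixes l :: "'i \<Rightarrow> nat"
  assumes inj: "inj_on l I" and s: "s \<ge> 1"
  shows "real (card {j \<in> I. \<bar>real (l i) - real (l j)\<bar> < s / 3}) \<le> s"
proof -
  let ?S = "{j \<in> I. \<bar>real (l i) - real (l j)\<bar> < s / 3}"
  \<comment> \<open>The largest integer strictly below \<open>s / 3\<close>, as the window is open;
    at most \<open>2 * m + 1\<close> labels fit.\<close>
  define m where "m = \<lceil>s / 3\<rceil> - 1"
  have m: "0 \<le> m" using s by (simp add: m_def)
  have "(\<lambda>j. int (l j)) ` ?S \<subseteq> {int (l i) - m .. int (l i) + m}"
  proof (rule image_subsetI)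
    fix j assume "j \<in> ?S"
    then have "\<bar>int (l i) - int (l j)\<bar> < \<lceil>s / 3\<rceil>"
      by (simp add: less_ceiling_iff)
    then show "int (l j) \<in> {int (l i) - m .. int (l i) + m}"
      by (auto simp: m_def)
  qed
  then have "card ((\<lambda>j. int (l j)) ` ?S) \<le> card {int (l i) - m .. int (l i) + m}"
    by (intro card_mono) auto
  moreover have "card ((\<lambda>j. int (l j)) ` ?S) = card ?S"
    using inj by (intro card_image) (auto simp: inj_on_def)
  ultimately have "real (card ?S) \<le> 2 * real_of_int m + 1"
    using m by simp
  also have "\<dots> \<le> s"
  \<comment> \<open>For \<open>s \<le> 3\<close> at most one label fits, and
    \<open>1 \<le> s\<close>. For \<open>s > 3\<close> the count is at most
    \<open>2 * s / 3 + 1\<close>, which is below \<open>s\<close>; this is the reason for the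
    third.\<close>
  proof (cases "s \<le> 3")
    case True
    then have "m \<le> 0" by (simp add: m_def)
    then show ?thesis using s by (smt (verit) of_int_le_0_iff)
  next
    case False
    have "real_of_int m \<le> s / 3" unfolding m_def by linarith
    then show ?thesis using False by linarith
  qed
  finally show ?thesis .
qed


section \<open>The inverse of the Schur complement\<close>

lemma M_mat_eq_dom_mat: "M_mat N = dom_mat (lam N) (wgt N)"
  by (intro ext) (simp add: M_mat_def dom_mat_def)

lemma dominant_network_row_dominant:
  assumes "dominant_network lbar \<zeta> N"
  shows "row_dominant \<zeta> (agents N) (lam N) (wgt N)"
    and "row_dominant \<zeta> (agents N) (lam N) (\<lambda>i j. wgt N j i)"
  using assms by (auto simp: dominant_network_def row_dominant_def agents_def)

text \<open>Block elimination. \<open>M X = I\<close> gives \<open>M_LO X_OO = - M_LL X_LO\<close>,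
  which turns \<open>H X_OO\<close> into \<open>M_OO X_OO + M_OL X_LO = I\<close>. The product in
  the other order uses \<open>X M = I\<close> in the same way.\<close>

lemma inverse_on_H_mat:
  assumes fin: "finite (obs N)" "finite (lat N)" and disj: "obs N \<inter> lat N = {}"
    and X: "inverse_on (agents N) (M_mat N) X"
    and P: "inverse_on (lat N) (M_mat N) (minv (lat N) (M_mat N))"
  shows "inverse_on (obs N) (H_mat N) X"
proof -
  let ?M = "M_mat N" and ?S = "S_mat N" and ?P = "minv (lat N) (M_mat N)"
  let ?O = "obs N" and ?L = "lat N"
  have split: "(\<Sum>k\<in>agents N. f k) = (\<Sum>k\<in>?O. f k) + (\<Sum>k\<in>?L. f k)" for f :: "'a \<Rightarrow> real"
    unfolding agents_def by (rule sum.union_disjoint) (use fin disj in auto)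
  have MX: "(\<Sum>k\<in>?O. ?M i k * X k j) + (\<Sum>k\<in>?L. ?M i k * X k j) = of_bool (i = j)"
    and XM: "(\<Sum>k\<in>?O. X i k * ?M k j) + (\<Sum>k\<in>?L. X i k * ?M k j) = of_bool (i = j)"
    if "i \<in> ?O \<union> ?L" "j \<in> ?O \<union> ?L" for i j
    using X that unfolding inverse_on_def mmul_def split by (auto simp: agents_def)
  have SM: "(\<Sum>l\<in>?L. ?S i l * ?M l k) = ?M i k" if k: "k \<in> ?L" for i k
  proof -
    have "(\<Sum>l\<in>?L. ?S i l * ?M l k) = (\<Sum>l\<in>?L. \<Sum>l'\<in>?L. ?M i l' * ?P l' l * ?M l k)"
      by (simp add: S_mat_def mmul_def sum_distrib_right)
    also have "\<dots> = (\<Sum>l'\<in>?L. \<Sum>l\<in>?L. ?M i l' * ?P l' l * ?M l k)"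
      by (rule sum.swap)
    also have "\<dots> = (\<Sum>l'\<in>?L. ?M i l' * mmul ?L ?P ?M l' k)"
      by (simp add: mmul_def sum_distrib_left mult.assoc)
    also have "\<dots> = (\<Sum>l'\<in>?L. ?M i l' * of_bool (l' = k))"
      using P k by (intro sum.cong) (auto simp: inverse_on_def)
    also have "\<dots> = ?M i k"
      using fin k by (simp add: of_bool_def if_distrib[of "\<lambda>x. _ * x"] sum.delta cong: if_cong)
    finally show ?thesis .
  qed
  have XS: "(\<Sum>k\<in>?O. X i k * ?S k l) = - X i l" if i: "i \<in> ?O" and l: "l \<in> ?L" for i l
  proof -
    \<comment> \<open>Stated for any \<open>J\<close> because the sum over the observable agents is
      to be traded for minus the sum over the latent ones.\<close>
    have *: "(\<Sum>k\<in>J. X i k * ?S k l) = (\<Sum>l'\<in>?L. (\<Sum>k\<in>J. X i k * ?M k l') * ?P l' l)" for J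
    proof -
      have "(\<Sum>k\<in>J. X i k * ?S k l) = (\<Sum>k\<in>J. \<Sum>l'\<in>?L. X i k * ?M k l' * ?P l' l)"
        by (simp add: S_mat_def mmul_def sum_distrib_left mult.assoc)
      also have "\<dots> = (\<Sum>l'\<in>?L. \<Sum>k\<in>J. X i k * ?M k l' * ?P l' l)"
        by (rule sum.swap)
      finally show ?thesis by (simp add: sum_distrib_right)
    qed
    have neg: "(\<Sum>k\<in>?O. X i k * ?M k l') = - (\<Sum>k\<in>?L. X i k * ?M k l')" if "l' \<in> ?L" for l'
    proof -
      have "i \<noteq> l'" using i that disj by auto
      then show ?thesis using XM[of i l'] i that by simp
    qed
    have "(\<Sum>k\<in>?O. X i k * ?S k l) = - (\<Sum>k\<in>?L. X i k * ?S k l)"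
      unfolding * using neg by (simp add: sum_negf)
    \<comment> \<open>In latent rows \<open>S_mat\<close> is \<open>M_LL\<close> times its own
      inverse, hence the identity.\<close>
    also have "(\<Sum>k\<in>?L. X i k * ?S k l) = (\<Sum>k\<in>?L. X i k * of_bool (k = l))"
      using P l by (intro sum.cong) (auto simp: inverse_on_def S_mat_def)
    also have "\<dots> = X i l"
      using fin l by (simp add: of_bool_def if_distrib[of "\<lambda>x. _ * x"] sum.delta cong: if_cong)
    finally show ?thesis .
  qed
  have HX: "mmul ?O (H_mat N) X i j = of_bool (i = j)" if i: "i \<in> ?O" and j: "j \<in> ?O" for i j
  proof -
    have neg: "(\<Sum>k\<in>?O. ?M l k * X k j) = - (\<Sum>k\<in>?L. ?M l k * X k j)" if "l \<in> ?L" for l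
    proof -
      have "l \<noteq> j" using j that disj by auto
      then show ?thesis using MX[of l j] j that by simp
    qed
    have *: "(\<Sum>k\<in>J. (\<Sum>l\<in>?L. ?S i l * ?M l k) * X k j) = (\<Sum>l\<in>?L. ?S i l * (\<Sum>k\<in>J. ?M l k * X k j))" for J
    proof -
      have "(\<Sum>k\<in>J. (\<Sum>l\<in>?L. ?S i l * ?M l k) * X k j) = (\<Sum>k\<in>J. \<Sum>l\<in>?L. ?S i l * (?M l k * X k j))"
        by (simp add: sum_distrib_right mult.assoc)
      also have "\<dots> = (\<Sum>l\<in>?L. \<Sum>k\<in>J. ?S i l * (?M l k * X k j))"
        by (rule sum.swap)
      finally show ?thesis by (simp add: sum_distrib_left)
    qed
    have "mmul ?O (H_mat N) X i j =
        (\<Sum>k\<in>?O. ?M i k * X k j) - (\<Sum>k\<in>?O. (\<Sum>l\<in>?L. ?S i l * ?M l k) * X k j)"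
      by (simp add: mmul_def H_mat_def left_diff_distrib sum_subtractf)
    also have "(\<Sum>k\<in>?O. (\<Sum>l\<in>?L. ?S i l * ?M l k) * X k j) = - (\<Sum>k\<in>?L. (\<Sum>l\<in>?L. ?S i l * ?M l k) * X k j)"
      unfolding * using neg by (simp add: sum_negf)
    also have "(\<Sum>k\<in>?L. (\<Sum>l\<in>?L. ?S i l * ?M l k) * X k j) = (\<Sum>k\<in>?L. ?M i k * X k j)"
      using SM by simp
    finally show ?thesis using MX[of i j] i j by simp
  qed
  have XH: "mmul ?O X (H_mat N) i j = of_bool (i = j)" if i: "i \<in> ?O" and j: "j \<in> ?O" for i j
  proof -
    have "mmul ?O X (H_mat N) i j =
        (\<Sum>k\<in>?O. X i k * ?M k j) - (\<Sum>k\<in>?O. \<Sum>l\<in>?L. X i k * ?S k l * ?M l j)"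
      by (simp add: mmul_def H_mat_def right_diff_distrib sum_subtractf sum_distrib_left mult.assoc)
    also have "(\<Sum>k\<in>?O. \<Sum>l\<in>?L. X i k * ?S k l * ?M l j) = (\<Sum>l\<in>?L. (\<Sum>k\<in>?O. X i k * ?S k l) * ?M l j)"
      by (subst sum.swap) (simp add: sum_distrib_right)
    also have "\<dots> = - (\<Sum>l\<in>?L. X i l * ?M l j)"
      using XS[OF i] by (simp add: sum_negf)
    finally show ?thesis using XM[of i j] i j by simp
  qed
  show ?thesis using HX XH by (simp add: inverse_on_def)
qed

text \<open>The latent block inherits dominance, so its \<open>minv\<close> is a genuine inverse and
  block elimination applies. Estimates on the full inverse \<open>X\<close> then carry over to
  \<open>H_inv\<close>.\<close>

lemma dominant_network_H_inv:
  assumes dom: "dominant_network lbar \<zeta> N" and \<zeta>: "\<zeta> > 0"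
  obtains X where "inverse_on (agents N) (M_mat N) X"
    "\<And>i j. i \<in> obs N \<Longrightarrow> j \<in> obs N \<Longrightarrow> H_inv N i j = X i j"
proof -
  note rd = dominant_network_row_dominant[OF dom]
  have sub: "lat N \<subseteq> agents N" by (simp add: agents_def)
  obtain X where X: "inverse_on (agents N) (M_mat N) X"
    using dominant_inverse[OF rd \<zeta>] by (auto simp: M_mat_eq_dom_mat)
  obtain P where "inverse_on (lat N) (M_mat N) P"
    using dominant_inverse[OF rd[THEN row_dominant_subset[OF _ sub]] \<zeta>] by (auto simp: M_mat_eq_dom_mat)
  then have "inverse_on (obs N) (H_mat N) X"
    using dom X by (intro inverse_on_H_mat inverse_on_minv) (auto simp: dominant_network_def)
  then have "H_inv N i j = X i j" if "i \<in> obs N" "j \<in> obs N" for i j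
    unfolding H_inv_def using dom that by (intro minv_eq) (auto simp: dominant_network_def)
  then show ?thesis using X that by blast
qed


section \<open>Sparse approximation under polynomial decay\<close>

text \<open>With \<open>x = ln d / n\<close>, positive because \<open>d \<ge> 2\<close>, everything
  is a power of \<open>x\<close>; in particular \<open>s_rate\<close> is
  \<open>x powr (- 1 / (2 * \<theta>))\<close>. The third identity balances the error on the support
  against the approximation radius.\<close>

lemma rate_eq_powr:
  assumes "\<theta> > 1" "n \<ge> (1::nat)" "d \<ge> (2::real)"
  shows "s_rate \<theta> n d > 0"
    and "(ln d / real n) powr ((\<theta> - 1) / (2 * \<theta>)) = s_rate \<theta> n d powr (- (\<theta> - 1))"
    and "s_rate \<theta> n d * sqrt (ln d / real n) = (ln d / real n) powr ((\<theta> - 1) / (2 * \<theta>))"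
proof -
  define x where "x = ln d / real n"
  have x: "x > 0" using assms by (simp add: x_def)
  have s: "s_rate \<theta> n d = x powr (- (1 / (2 * \<theta>)))"
    using x by (simp add: s_rate_def x_def powr_minus powr_divide inverse_eq_divide)
  show "s_rate \<theta> n d > 0" using x by (simp add: s)
  show "(ln d / real n) powr ((\<theta> - 1) / (2 * \<theta>)) = s_rate \<theta> n d powr (- (\<theta> - 1))"
  proof -
    have "- (1 / (2 * \<theta>)) * (- (\<theta> - 1)) = (\<theta> - 1) / (2 * \<theta>)"
      by (subst minus_mult_minus) simp
    then show ?thesis by (simp only: s powr_powr x_def)
  qed
  have "s_rate \<theta> n d * sqrt x = x powr (- (1 / (2 * \<theta>)) + 1 / 2)"
    using x by (subst powr_add) (simp add: s powr_half_sqrt)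
  also have "- (1 / (2 * \<theta>)) + 1 / 2 = (\<theta> - 1) / (2 * \<theta>)"
    using assms by (simp add: field_simps)
  finally show "s_rate \<theta> n d * sqrt (ln d / real n) = (ln d / real n) powr ((\<theta> - 1) / (2 * \<theta>))"
    by (simp add: x_def)
qed

lemma norm_le_of_row_col_sums:
  assumes "finite I" "I \<noteq> {}" "\<And>i. i \<in> I \<Longrightarrow> (\<Sum>j\<in>I. \<bar>A i j\<bar>) \<le> r"
    "\<And>j. j \<in> I \<Longrightarrow> (\<Sum>i\<in>I. \<bar>A i j\<bar>) \<le> r"
  shows "norm_1 I A \<le> r" "norm_inf I A \<le> r"
  using assms by (auto simp: norm_1_def norm_inf_def)

text \<open>For \<open>s < 1\<close> the only \<open>s\<close>-sparse matrix is zero, but then \<open>s\<^sup>-\<^sup>\<alpha> > 1\<close>, so the bound \<open>1 / \<zeta>\<close> on the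
  row sums suffices.\<close>

lemma truncation_row:
  fixes x :: "'i \<Rightarrow> real" and l :: "'i \<Rightarrow> nat"
  assumes I: "finite I" and O: "J \<subseteq> I" and inj: "inj_on l I"
    and s: "s > 0" and \<alpha>: "\<alpha> > 0" and A: "A \<ge> 0"
    and sum: "(\<Sum>j\<in>I. \<bar>x j\<bar>) \<le> R"
    and tail: "\<And>b. b > 0 \<Longrightarrow> (\<Sum>j | j \<in> I \<and> b \<le> \<bar>real (l i) - real (l j)\<bar>. \<bar>x j\<bar>) \<le> A * b powr (- \<alpha>)"
    and w: "\<And>j. j \<in> J \<Longrightarrow> w j = (if 1 \<le> s \<and> \<bar>real (l i) - real (l j)\<bar> < s / 3 then x j else 0)"
  shows "real (card {j\<in>J. w j \<noteq> 0}) \<le> s"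
    and "(\<Sum>j\<in>J. \<bar>x j - w j\<bar>) \<le> (A * 3 powr \<alpha> + R) * s powr (- \<alpha>)"
proof -
  have R: "0 \<le> R" using sum by (meson abs_ge_zero order_trans sum_nonneg)
  have "{j\<in>J. w j \<noteq> 0} \<subseteq> (if 1 \<le> s then {j \<in> I. \<bar>real (l i) - real (l j)\<bar> < s / 3} else {})"
    using O by (auto simp: w split: if_splits)
  then have "real (card {j\<in>J. w j \<noteq> 0}) \<le>
      real (card (if 1 \<le> s then {j \<in> I. \<bar>real (l i) - real (l j)\<bar> < s / 3} else {}))"
    using I by (intro of_nat_mono card_mono) auto
  also have "\<dots> \<le> s"
    using card_near_le[OF inj] s by auto
  finally show "real (card {j\<in>J. w j \<noteq> 0}) \<le> s" .
  show "(\<Sum>j\<in>J. \<bar>x j - w j\<bar>) \<le> (A * 3 powr \<alpha> + R) * s powr (- \<alpha>)"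
  proof (cases "1 \<le> s")
    case True
    \<comment> \<open>Entries inside the window cancel, which leaves the tail at radius
      \<open>s / 3\<close>.\<close>
    have "(\<Sum>j\<in>J. \<bar>x j - w j\<bar>) = (\<Sum>j | j \<in> J \<and> s / 3 \<le> \<bar>real (l i) - real (l j)\<bar>. \<bar>x j\<bar>)"
      using True finite_subset[OF O I]
      by (intro sum.mono_neutral_cong_right) (auto simp: w)
    also have "\<dots> \<le> (\<Sum>j | j \<in> I \<and> s / 3 \<le> \<bar>real (l i) - real (l j)\<bar>. \<bar>x j\<bar>)"
      using I O by (intro sum_mono2) auto
    also have "\<dots> \<le> A * (s / 3) powr (- \<alpha>)"
      using s by (intro tail) auto
    also have "\<dots> = A * 3 powr \<alpha> * s powr (- \<alpha>)"
      using s by (simp add: powr_divide powr_minus field_simps)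
    also have "\<dots> \<le> (A * 3 powr \<alpha> + R) * s powr (- \<alpha>)"
      using R by (intro mult_right_mono) auto
    finally show ?thesis .
  next
    case False
    have "(\<Sum>j\<in>J. \<bar>x j - w j\<bar>) = (\<Sum>j\<in>J. \<bar>x j\<bar>)"
      using False by (intro sum.cong) (auto simp: w)
    also have "\<dots> \<le> (\<Sum>j\<in>I. \<bar>x j\<bar>)"
      using I O by (intro sum_mono2) auto
    also have "\<dots> \<le> R * 1" using sum by simp
    also have "\<dots> \<le> R * s powr (- \<alpha>)"
      using powr_mono2'[of "- \<alpha>" s 1] False s \<alpha> R by (intro mult_left_mono) auto
    also have "\<dots> \<le> (A * 3 powr \<alpha> + R) * s powr (- \<alpha>)"
      using A by (intro mult_right_mono) auto
    finally show ?thesis .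
  qed
qed

text \<open>The approximation is \<open>X\<close> cut off outside a window of label distance. All
  constants are built from \<open>\<theta>\<close>, \<open>Ct\<close>, \<open>\<zeta>\<close> and
  \<open>lbar\<close> before the network is fixed.\<close>

lemma H_inv_sparse_approximation:
  fixes \<theta> Ct \<zeta> lbar :: real
  assumes \<theta>: "\<theta> > 1" and Ct: "Ct > 0" and \<zeta>: "\<zeta> > 0"
  shows "\<exists>Ct1>0. \<forall>(N :: 'v network) l n.
    n \<ge> 1 \<and> card (obs N) \<ge> 2 \<and> dominant_network lbar \<zeta> N \<and> decaying_weights \<theta> Ct l N \<longrightarrow>
    sparse_approximation (obs N) (s_rate \<theta> n (real (card (obs N))))
      (r_rate \<theta> Ct1 n (real (card (obs N)))) (H_inv N)"
proof -
  \<comment> \<open>The term \<open>2 * \<zeta>\<close> forces \<open>\<zeta> < L\<close>, hence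
    \<open>0 < q < 1\<close>, for any \<open>lbar\<close>.\<close>
  define L where "L = max lbar (2 * \<zeta>)"
  define \<alpha> where "\<alpha> = \<theta> - 1"
  define q where "q = 1 - \<zeta> / L"
  define \<eta> where "\<eta> = q powr (1 / (2 * \<alpha>))"
  define K where "K = 2 * Ct / (\<theta> - 1)"
  define A where "A = K * (1 - \<eta>) powr (- \<alpha>) / \<zeta>\<^sup>2 / (1 - sqrt q)"
  define D where "D = A * 3 powr \<alpha> + 1 / \<zeta>"
  have L: "\<zeta> < L" using \<zeta> by (simp add: L_def)
  have \<alpha>: "\<alpha> > 0" and K: "K \<ge> 0" using \<theta> Ct by (simp_all add: \<alpha>_def K_def)
  have "sqrt q < 1" using L \<zeta> by (simp add: q_def)
  then have A: "A \<ge> 0" using K by (simp add: A_def)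
  then have D: "D > 0" using \<zeta> by (simp add: D_def add_nonneg_pos)
  \<comment> \<open>Chosen to cancel the factor \<open>2 powr \<theta> / (\<theta> - 1)\<close> of
    \<open>r_rate\<close>, leaving \<open>D * s powr (- \<alpha>)\<close>.\<close>
  define Ct1 where "Ct1 = D * (\<theta> - 1) / 2 powr \<theta>"
  have "sparse_approximation (obs N) (s_rate \<theta> n (real (card (obs N))))
      (r_rate \<theta> Ct1 n (real (card (obs N)))) (H_inv N)"
    if n: "n \<ge> 1" and card: "card (obs N) \<ge> 2" and dom: "dominant_network lbar \<zeta> N"
      and dec: "decaying_weights \<theta> Ct l N" for N :: "'v network" and l n
  proof -
    define s where "s = s_rate \<theta> n (real (card (obs N)))"
    have s: "s > 0" using rate_eq_powr(1)[OF \<theta> n] card by (simp add: s_def)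
    have r: "r_rate \<theta> Ct1 n (real (card (obs N))) = D * s powr (- \<alpha>)"
      using rate_eq_powr(2)[OF \<theta> n, of "real (card (obs N))"] card \<theta>
      by (simp add: r_rate_def Ct1_def s_def \<alpha>_def)
    note rd = dominant_network_row_dominant[OF dom]
    have I: "finite (agents N)" and O: "obs N \<subseteq> agents N" and fO: "finite (obs N)"
      using dom by (auto simp: dominant_network_def agents_def)
    have inj: "inj_on l (agents N)" using dec by (simp add: decaying_weights_def bij_betw_def)
    have u: "lam N i \<le> L" if "i \<in> agents N" for i
      using dom that unfolding dominant_network_def L_def by fastforce
    obtain X where X: "inverse_on (agents N) (M_mat N) X"
      and HX: "\<And>i j. i \<in> obs N \<Longrightarrow> j \<in> obs N \<Longrightarrow> H_inv N i j = X i j"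
      using dominant_network_H_inv[OF dom \<zeta>] by blast
    have X1: "\<forall>i\<in>agents N. \<forall>j\<in>agents N. mmul (agents N) (dom_mat (lam N) (wgt N)) X i j = of_bool (i = j)"
      using X by (simp add: inverse_on_def M_mat_eq_dom_mat)
    \<comment> \<open>The left inverse identity transposed, so that column sums of \<open>X\<close>
      become row sums.\<close>
    have X2: "\<forall>i\<in>agents N. \<forall>j\<in>agents N.
        mmul (agents N) (dom_mat (lam N) (\<lambda>i j. wgt N j i)) (\<lambda>i j. X j i) i j = of_bool (i = j)"
    proof (intro ballI)
      fix i j assume "i \<in> agents N" "j \<in> agents N"
      then have "mmul (agents N) X (dom_mat (lam N) (wgt N)) j i = of_bool (i = j)"
        using X by (auto simp: inverse_on_def M_mat_eq_dom_mat)
      then show "mmul (agents N) (dom_mat (lam N) (\<lambda>i j. wgt N j i)) (\<lambda>i j. X j i) i j = of_bool (i = j)"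
        by (simp add: dom_mat_transpose[of "lam N" "wgt N"]
            mmul_transpose[of "agents N" "dom_mat (lam N) (wgt N)" X i j])
    qed
    have G1: "(\<Sum>k | k \<in> agents N \<and> b \<le> \<bar>real (l i) - real (l k)\<bar>. wgt N i k) \<le> K * b powr (- \<alpha>)"
      and G2: "(\<Sum>k | k \<in> agents N \<and> b \<le> \<bar>real (l i) - real (l k)\<bar>. wgt N k i) \<le> K * b powr (- \<alpha>)"
      if "i \<in> agents N" "b > 0" for i b
    proof -
      have "wgt N i k \<le> Ct / (1 + \<bar>real (l i) - real (l k)\<bar>) powr \<theta>"
        "wgt N k i \<le> Ct / (1 + \<bar>real (l k) - real (l i)\<bar>) powr \<theta>" if "k \<in> agents N" for k
        using dec \<open>i \<in> agents N\<close> that by (auto simp: decaying_weights_def)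
      moreover have "\<bar>real (l k) - real (l i)\<bar> = \<bar>real (l i) - real (l k)\<bar>" for k
        by (rule abs_minus_commute)
      ultimately have dec': "wgt N i k \<le> Ct / (1 + \<bar>real (l i) - real (l k)\<bar>) powr \<theta>"
        "wgt N k i \<le> Ct / (1 + \<bar>real (l i) - real (l k)\<bar>) powr \<theta>" if "k \<in> agents N" for k
        using that by metis+
      show "(\<Sum>k | k \<in> agents N \<and> b \<le> \<bar>real (l i) - real (l k)\<bar>. wgt N i k) \<le> K * b powr (- \<alpha>)"
        "(\<Sum>k | k \<in> agents N \<and> b \<le> \<bar>real (l i) - real (l k)\<bar>. wgt N k i) \<le> K * b powr (- \<alpha>)"
        unfolding K_def \<alpha>_def
        by (rule decaying_row_tail[OF \<theta> less_imp_le[OF Ct] I inj dec'(1) that(2)]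
            decaying_row_tail[OF \<theta> less_imp_le[OF Ct] I inj dec'(2) that(2)]; assumption)+
    qed
    have T1: "(\<Sum>j | j \<in> agents N \<and> b \<le> \<bar>real (l i) - real (l j)\<bar>. \<bar>X i j\<bar>) \<le> A * b powr (- \<alpha>)"
      if "i \<in> agents N" "b > 0" for i b
      by (rule right_inverse_row_tail[where pos = "\<lambda>i. real (l i)", OF rd(1) \<zeta> X1 u L \<alpha> K G1 q_def \<eta>_def A_def that])
    have T2: "(\<Sum>j | j \<in> agents N \<and> b \<le> \<bar>real (l i) - real (l j)\<bar>. \<bar>X j i\<bar>) \<le> A * b powr (- \<alpha>)"
      if "i \<in> agents N" "b > 0" for i b
      by (rule right_inverse_row_tail[where pos = "\<lambda>i. real (l i)", OF rd(2) \<zeta> X2 u L \<alpha> K G2 q_def \<eta>_def A_def that])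
    define W where "W i j = (if 1 \<le> s \<and> \<bar>real (l i) - real (l j)\<bar> < s / 3 then X i j else 0)" for i j
    \<comment> \<open>The window is symmetric, so the same \<open>W\<close> also truncates the
      columns of \<open>X\<close>.\<close>
    have W': "W i j = (if 1 \<le> s \<and> \<bar>real (l j) - real (l i)\<bar> < s / 3 then X i j else 0)" for i j
      by (simp add: W_def abs_minus_commute)
    have row: "real (card {j\<in>obs N. W i j \<noteq> 0}) \<le> s" "(\<Sum>j\<in>obs N. \<bar>X i j - W i j\<bar>) \<le> D * s powr (- \<alpha>)"
      if "i \<in> obs N" for i
    proof -
      have i: "i \<in> agents N" using that O by auto
      note * = truncation_row[where x = "X i" and l = l and i = i and w = "W i",
          OF I O inj s \<alpha> A right_inverse_row_sum[OF rd(1) \<zeta> X1 i] T1[OF i] W_def]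
      show "real (card {j\<in>obs N. W i j \<noteq> 0}) \<le> s"
        "(\<Sum>j\<in>obs N. \<bar>X i j - W i j\<bar>) \<le> D * s powr (- \<alpha>)"
        unfolding D_def by (rule *, assumption)+
    qed
    have col: "real (card {i\<in>obs N. W i j \<noteq> 0}) \<le> s" "(\<Sum>i\<in>obs N. \<bar>X i j - W i j\<bar>) \<le> D * s powr (- \<alpha>)"
      if "j \<in> obs N" for j
    proof -
      have j: "j \<in> agents N" using that O by auto
      note * = truncation_row[where x = "\<lambda>i. X i j" and l = l and i = j and w = "\<lambda>i. W i j",
          OF I O inj s \<alpha> A right_inverse_row_sum[OF rd(2) \<zeta> X2 j] T2[OF j] W']
      show "real (card {i\<in>obs N. W i j \<noteq> 0}) \<le> s"
        "(\<Sum>i\<in>obs N. \<bar>X i j - W i j\<bar>) \<le> D * s powr (- \<alpha>)"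
        unfolding D_def by (rule *, assumption)+
    qed
    have "norm_1 (obs N) (\<lambda>i j. H_inv N i j - W i j) \<le> D * s powr (- \<alpha>)"
      "norm_inf (obs N) (\<lambda>i j. H_inv N i j - W i j) \<le> D * s powr (- \<alpha>)"
      using card by (intro norm_le_of_row_col_sums fO; auto simp: HX row col)+
    then show ?thesis
      unfolding sparse_approximation_def r s_def[symmetric]
      using row col by (intro exI[of _ W]) (auto simp: sparse_on_def)
  qed
  moreover have "Ct1 > 0" using D \<theta> by (simp add: Ct1_def)
  ultimately show ?thesis by blast
qed


section \<open>Thresholding\<close>

text \<open>An entry on the support of \<open>wb\<close> costs at most \<open>3 / 2 * B\<close>
  beyond its approximation error; any other costs at most that error.\<close>

lemma threshold_vector_error:
  fixes h w wb \<mu> :: "'i \<Rightarrow> real"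
  assumes J: "finite J" and B: "B \<ge> 0"
    and err: "\<And>j. j \<in> J \<Longrightarrow> 2 * \<bar>w j - h j\<bar> \<le> \<mu> j" "\<And>j. j \<in> J \<Longrightarrow> \<mu> j \<le> B"
    and card: "real (card {j\<in>J. wb j \<noteq> 0}) \<le> s" and r: "(\<Sum>j\<in>J. \<bar>h j - wb j\<bar>) \<le> r"
  shows "(\<Sum>j\<in>J. \<bar>(if \<mu> j < \<bar>w j\<bar> then w j else 0) - h j\<bar>) \<le> 3 / 2 * B * s + r"
proof -
  \<comment> \<open>A kept entry has \<open>|w| > \<mu>\<close>, so
    \<open>|h| > \<mu> / 2 \<ge> |w - h|\<close>; a dropped one has error
    \<open>|h| \<le> 3 / 2 * \<mu>\<close>. Where \<open>wb\<close> vanishes,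
    \<open>|h| = |h - wb|\<close>.\<close>
  have "\<bar>(if \<mu> j < \<bar>w j\<bar> then w j else 0) - h j\<bar> \<le>
      3 / 2 * B * of_bool (wb j \<noteq> 0) + \<bar>h j - wb j\<bar>" if "j \<in> J" for j
    using err[OF that] B by (cases "wb j = 0") (auto simp: of_bool_def abs_if split: if_splits)
  then have "(\<Sum>j\<in>J. \<bar>(if \<mu> j < \<bar>w j\<bar> then w j else 0) - h j\<bar>) \<le>
      (\<Sum>j\<in>J. 3 / 2 * B * of_bool (wb j \<noteq> 0) + \<bar>h j - wb j\<bar>)"
    by (rule sum_mono)
  also have "\<dots> = 3 / 2 * B * (\<Sum>j\<in>J. of_bool (wb j \<noteq> 0)) + (\<Sum>j\<in>J. \<bar>h j - wb j\<bar>)"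
    by (simp add: sum.distrib sum_distrib_left)
  also have "(\<Sum>j\<in>J. of_bool (wb j \<noteq> 0)) = real (card {j\<in>J. wb j \<noteq> 0})"
    using J by (simp add: of_bool_def sum.If_cases Int_def)
  also have "3 / 2 * B * real (card {j\<in>J. wb j \<noteq> 0}) + (\<Sum>j\<in>J. \<bar>h j - wb j\<bar>) \<le> 3 / 2 * B * s + r"
    using card r B by (intro add_mono mult_left_mono) auto
  finally show ?thesis .
qed

text \<open>Both norms are maxima of sums along a row or a column, and sparsity holds in both
  directions, so the vector bound serves each line.\<close>

lemma threshold_error:
  assumes I: "finite I" "I \<noteq> {}" and B: "B \<ge> 0"
    and sp: "sparse_approximation I s r H"
    and err: "\<And>k j. k \<in> I \<Longrightarrow> j \<in> I \<Longrightarrow> 2 * \<bar>W k j - H k j\<bar> \<le> \<mu> k j \<and> \<mu> k j \<le> B"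
  shows "max (norm_inf I (\<lambda>k j. threshold \<mu> W k j - H k j))
    (norm_1 I (\<lambda>k j. threshold \<mu> W k j - H k j)) \<le> 3 / 2 * B * s + r"
proof -
  obtain Wb where Wb: "sparse_on I s Wb" "norm_1 I (\<lambda>i j. H i j - Wb i j) \<le> r"
    "norm_inf I (\<lambda>i j. H i j - Wb i j) \<le> r"
    using sp by (auto simp: sparse_approximation_def)
  have row: "(\<Sum>j\<in>I. \<bar>H k j - Wb k j\<bar>) \<le> r" and col: "(\<Sum>i\<in>I. \<bar>H i k - Wb i k\<bar>) \<le> r"
    if "k \<in> I" for k
    using that Wb(2,3) I by (auto simp: norm_1_def norm_inf_def)
  have "(\<Sum>j\<in>I. \<bar>threshold \<mu> W k j - H k j\<bar>) \<le> 3 / 2 * B * s + r"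
    "(\<Sum>i\<in>I. \<bar>threshold \<mu> W i k - H i k\<bar>) \<le> 3 / 2 * B * s + r" if k: "k \<in> I" for k
  proof -
    show "(\<Sum>j\<in>I. \<bar>threshold \<mu> W k j - H k j\<bar>) \<le> 3 / 2 * B * s + r"
      unfolding threshold_def using Wb(1) k
      by (intro threshold_vector_error[where wb = "Wb k"] I B row k)
         (simp_all add: err[THEN conjunct1] err[THEN conjunct2] sparse_on_def)
    show "(\<Sum>i\<in>I. \<bar>threshold \<mu> W i k - H i k\<bar>) \<le> 3 / 2 * B * s + r"
      unfolding threshold_def using Wb(1) k
      by (intro threshold_vector_error[where wb = "\<lambda>i. Wb i k"] I B col k)
         (simp_all add: err[THEN conjunct1] err[THEN conjunct2] sparse_on_def)
  qed
  then show ?thesis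
    using norm_le_of_row_col_sums[OF I, of "\<lambda>k j. threshold \<mu> W k j - H k j"] by simp
qed

section \<open>From deterministic bounds to probability \<open>1 - o(1)\<close>\<close>

lemma with_high_probability_mono:
  assumes "with_high_probability P Q" "\<forall>\<^sub>F n in sequentially. \<forall>\<omega>. Q n \<omega> \<longrightarrow> R n \<omega>"
  shows "with_high_probability P R"
proof -
  obtain A where A: "\<And>n. A n \<in> sets (P n)" "\<And>n \<omega>. \<omega> \<in> A n \<Longrightarrow> Q n \<omega>"
    "(\<lambda>n. measure (P n) (A n)) \<longlonglongrightarrow> 1"
    using assms(1) by (auto simp: with_high_probability_def)
  \<comment> \<open>The empty set at the exceptional \<open>n\<close> keeps the event measurable and
    inside \<open>R n\<close> for every \<open>n\<close>, without affecting the limit.\<close>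
  define A' where "A' n = (if \<forall>\<omega>. Q n \<omega> \<longrightarrow> R n \<omega> then A n else {})" for n
  have "(\<lambda>n. measure (P n) (A' n)) \<longlonglongrightarrow> 1"
    by (rule tendsto_cong[THEN iffD1, OF _ A(3)])
       (use assms(2) in \<open>rule eventually_mono; simp add: A'_def\<close>)
  then show ?thesis
    unfolding with_high_probability_def using A(1,2) by (intro exI[of _ A']) (auto simp: A'_def)
qed

text \<open>The first conjunct supplies a constant for the sparse approximation; the second gives
  the error bound for every positive \<open>Ct1\<close>. All constants are quantified before the
  models and so depend neither on \<open>n\<close> nor on the network.\<close>

theorem corollary2:
  fixes \<theta> Ct abar lbar pbar \<zeta> c C C' CPsi :: real
  assumes "\<theta> > 1" "Ct > 0" "\<zeta> > 0" "0 < c" "c < C" "C' > 0"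
  shows "(\<exists>Ct1>0. \<forall>(N :: 'v network) l n.
            n \<ge> 1 \<and> card (obs N) \<ge> 2 \<and> dominant_network lbar \<zeta> N \<and> decaying_weights \<theta> Ct l N \<longrightarrow>
            sparse_approximation (obs N) (s_rate \<theta> n (real (card (obs N))))
              (r_rate \<theta> Ct1 n (real (card (obs N)))) (H_inv N)) \<and>
         (\<forall>Ct1>0. \<forall>C1. \<exists>Ct2>0. \<exists>Ct3>0.
            \<forall>(m :: nat \<Rightarrow> ('v, 'w) model) l Me MP W \<mu>.
            (\<forall>\<^sub>F n in sequentially. standing_assumptions abar lbar pbar \<zeta> n (m n)) \<and>
            (\<forall>\<^sub>F n in sequentially. decaying_weights \<theta> Ct (l n) (net (m n))) \<and>
            regular_design c C C' CPsi (\<lambda>n. s_rate \<theta> n (num_obs (m n)))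
              (\<lambda>n. r_rate \<theta> Ct1 n (num_obs (m n))) Me MP m \<and>
            (\<forall>\<^sub>F n in sequentially. debiased_estimator n (m n) (W n)) \<and>
            with_high_probability (\<lambda>n. prb (m n)) (\<lambda>n \<omega>.
              \<forall>k\<in>obs (net (m n)). \<forall>j\<in>obs (net (m n)).
                2 * \<bar>W n \<omega> k j - H_inv (net (m n)) k j\<bar> \<le> \<mu> n \<omega> k j \<and>
                \<mu> n \<omega> k j \<le> C1 * sqrt (ln (num_obs (m n)) / real n)) \<longrightarrow>
            with_high_probability (\<lambda>n. prb (m n)) (\<lambda>n \<omega>.
              max (norm_inf (obs (net (m n)))
                     (\<lambda>k j. threshold (\<mu> n \<omega>) (W n \<omega>) k j - H_inv (net (m n)) k j))
                  (norm_1 (obs (net (m n)))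
                     (\<lambda>k j. threshold (\<mu> n \<omega>) (W n \<omega>) k j - H_inv (net (m n)) k j))
              \<le> (Ct2 + Ct3 * 2 powr \<theta> / (\<theta> - 1)) *
                 (ln (num_obs (m n)) / real n) powr ((\<theta> - 1) / (2 * \<theta>))))"
proof (intro conjI allI impI)
  show "\<exists>Ct1>0. \<forall>(N :: 'v network) l n.
            n \<ge> 1 \<and> card (obs N) \<ge> 2 \<and> dominant_network lbar \<zeta> N \<and> decaying_weights \<theta> Ct l N \<longrightarrow>
            sparse_approximation (obs N) (s_rate \<theta> n (real (card (obs N))))
              (r_rate \<theta> Ct1 n (real (card (obs N)))) (H_inv N)"
    using assms by (intro H_inv_sparse_approximation)
next
  fix Ct1 C1 :: real
  assume Ct1: "Ct1 > 0"
  \<comment> \<open>\<open>C1\<close> may be nonpositive; the maximum keeps the threshold bound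
    nonnegative and the witness \<open>3 / 2 * B\<close> positive.\<close>
  define B where "B = max C1 1"
  have B: "B \<ge> 1" "C1 \<le> B" by (auto simp: B_def)
  let ?bound = "\<lambda>(m :: nat \<Rightarrow> ('v, 'w) model) W \<mu> n \<omega>.
    max (norm_inf (obs (net (m n))) (\<lambda>k j. threshold (\<mu> n \<omega>) (W n \<omega>) k j - H_inv (net (m n)) k j))
        (norm_1 (obs (net (m n))) (\<lambda>k j. threshold (\<mu> n \<omega>) (W n \<omega>) k j - H_inv (net (m n)) k j))
    \<le> (3 / 2 * B + Ct1 * 2 powr \<theta> / (\<theta> - 1)) * (ln (num_obs (m n)) / real n) powr ((\<theta> - 1) / (2 * \<theta>))"
  let ?good = "\<lambda>(m :: nat \<Rightarrow> ('v, 'w) model) W \<mu> n \<omega>.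
    \<forall>k\<in>obs (net (m n)). \<forall>j\<in>obs (net (m n)).
      2 * \<bar>W n \<omega> k j - H_inv (net (m n)) k j\<bar> \<le> \<mu> n \<omega> k j \<and>
      \<mu> n \<omega> k j \<le> C1 * sqrt (ln (num_obs (m n)) / real n)"
  have main: "with_high_probability (\<lambda>n. prb (m n)) (?bound m W \<mu>)"
    if stand: "\<forall>\<^sub>F n in sequentially. standing_assumptions abar lbar pbar \<zeta> n (m n)"
      and reg: "regular_design c C C' CPsi (\<lambda>n. s_rate \<theta> n (num_obs (m n)))
              (\<lambda>n. r_rate \<theta> Ct1 n (num_obs (m n))) Me MP m"
      and whp: "with_high_probability (\<lambda>n. prb (m n)) (?good m W \<mu>)"
    for m :: "nat \<Rightarrow> ('v, 'w) model" and Me MP W \<mu>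
  proof (rule with_high_probability_mono[OF whp])
    have reg': "\<forall>\<^sub>F n in sequentially.
        sparse_approximation (obs (net (m n))) (s_rate \<theta> n (num_obs (m n)))
          (r_rate \<theta> Ct1 n (num_obs (m n))) (H_inv (net (m n))) \<and>
        ln (real n) \<le> C' * ln (num_obs (m n))"
      using reg unfolding regular_design_def by (auto elim: eventually_mono)
    show "\<forall>\<^sub>F n in sequentially. \<forall>\<omega>. ?good m W \<mu> n \<omega> \<longrightarrow> ?bound m W \<mu> n \<omega>"
      using stand reg' eventually_ge_at_top[of 2]
    proof eventually_elim
      case (elim n)
      let ?V = "obs (net (m n))" and ?d = "num_obs (m n)"
      let ?rate = "(ln ?d / real n) powr ((\<theta> - 1) / (2 * \<theta>))"
      have fin: "finite ?V"
        using elim(1) by (auto simp: standing_assumptions_def dominant_network_def)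
      \<comment> \<open>\<open>C' * ln ?d\<close> dominates \<open>ln n > 0\<close>, and
        \<open>ln\<close> vanishes at 0 and 1, so there are at least two observable agents.\<close>
      have "0 < C' * ln ?d"
        using elim(2,3) ln_gt_zero[of "real n"] by linarith
      then have "ln ?d > 0" using assms(6) by (simp add: zero_less_mult_iff)
      then have "?d \<noteq> 0" "?d \<noteq> 1" by force+
      then have d: "?d \<ge> 2" and ne: "?V \<noteq> {}" by (auto simp: num_obs_def)
      have n: "n \<ge> 1" using elim(3) by simp
      have B0: "B * sqrt (ln ?d / real n) \<ge> 0" "C1 * sqrt (ln ?d / real n) \<le> B * sqrt (ln ?d / real n)"
        using B \<open>ln ?d > 0\<close> by (auto intro: mult_right_mono)
      \<comment> \<open>The support term \<open>s_rate * sqrt (ln ?d / n)\<close> equals the rate,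
        and \<open>r_rate\<close> is a multiple of it.\<close>
      have rate: "3 / 2 * (B * sqrt (ln ?d / real n)) * s_rate \<theta> n ?d + r_rate \<theta> Ct1 n ?d =
          (3 / 2 * B + Ct1 * 2 powr \<theta> / (\<theta> - 1)) * ?rate"
        using rate_eq_powr(3)[OF assms(1) n d, symmetric]
        by (simp add: r_rate_def algebra_simps)
      show ?case
      proof (intro allI impI)
        fix \<omega> assume good: "?good m W \<mu> n \<omega>"
        show "?bound m W \<mu> n \<omega>"
          unfolding rate[symmetric]
          using good B0(2)
          by (intro threshold_error[OF fin ne B0(1)] conjunct1[OF elim(2)]) (blast intro: order_trans)
      qed
    qed
  qed
  show "\<exists>Ct2>0. \<exists>Ct3>0.
            \<forall>(m :: nat \<Rightarrow> ('v, 'w) model) l Me MP W \<mu>.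
            (\<forall>\<^sub>F n in sequentially. standing_assumptions abar lbar pbar \<zeta> n (m n)) \<and>
            (\<forall>\<^sub>F n in sequentially. decaying_weights \<theta> Ct (l n) (net (m n))) \<and>
            regular_design c C C' CPsi (\<lambda>n. s_rate \<theta> n (num_obs (m n)))
              (\<lambda>n. r_rate \<theta> Ct1 n (num_obs (m n))) Me MP m \<and>
            (\<forall>\<^sub>F n in sequentially. debiased_estimator n (m n) (W n)) \<and>
            with_high_probability (\<lambda>n. prb (m n)) (?good m W \<mu>) \<longrightarrow>
            with_high_probability (\<lambda>n. prb (m n)) (\<lambda>n \<omega>.
              max (norm_inf (obs (net (m n)))
                     (\<lambda>k j. threshold (\<mu> n \<omega>) (W n \<omega>) k j - H_inv (net (m n)) k j))
                  (norm_1 (obs (net (m n)))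
                     (\<lambda>k j. threshold (\<mu> n \<omega>) (W n \<omega>) k j - H_inv (net (m n)) k j))
              \<le> (Ct2 + Ct3 * 2 powr \<theta> / (\<theta> - 1)) *
                 (ln (num_obs (m n)) / real n) powr ((\<theta> - 1) / (2 * \<theta>)))"
  \<comment> \<open>\<open>3 / 2 * B\<close> accounts for thresholding on the support, and
    \<open>Ct1\<close>, taken for \<open>Ct3\<close> below, for the sparse approximation.\<close>
  proof (rule exI[of _ "3 / 2 * B"], intro conjI)
    show "0 < 3 / 2 * B" using B by simp
  next
    show "\<exists>Ct3>0. \<forall>(m :: nat \<Rightarrow> ('v, 'w) model) l Me MP W \<mu>.
            (\<forall>\<^sub>F n in sequentially. standing_assumptions abar lbar pbar \<zeta> n (m n)) \<and>
            (\<forall>\<^sub>F n in sequentially. decaying_weights \<theta> Ct (l n) (net (m n))) \<and>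
            regular_design c C C' CPsi (\<lambda>n. s_rate \<theta> n (num_obs (m n)))
              (\<lambda>n. r_rate \<theta> Ct1 n (num_obs (m n))) Me MP m \<and>
            (\<forall>\<^sub>F n in sequentially. debiased_estimator n (m n) (W n)) \<and>
            with_high_probability (\<lambda>n. prb (m n)) (?good m W \<mu>) \<longrightarrow>
            with_high_probability (\<lambda>n. prb (m n)) (\<lambda>n \<omega>.
              max (norm_inf (obs (net (m n)))
                     (\<lambda>k j. threshold (\<mu> n \<omega>) (W n \<omega>) k j - H_inv (net (m n)) k j))
                  (norm_1 (obs (net (m n)))
                     (\<lambda>k j. threshold (\<mu> n \<omega>) (W n \<omega>) k j - H_inv (net (m n)) k j))
              \<le> (3 / 2 * B + Ct3 * 2 powr \<theta> / (\<theta> - 1)) *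
                 (ln (num_obs (m n)) / real n) powr ((\<theta> - 1) / (2 * \<theta>)))"
      by (intro exI[of _ Ct1] conjI allI impI Ct1; elim conjE) (rule main; assumption)
  qed
qed

end
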